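(* Let $A$ and $B$ be finite semidistributive lattices that both have the $n$-switching property, for the same $n$. Then: (1) $A*B$ is a semidistributive lattice; (2) rowmotion on $A*B$ and rowmotion on $B*A$ have the same orbit structure; (3) the orbits of rowmotion on $A*B$ and on $B*A$ correspond so that corresponding orbits have the same size and the same sum of the down-degree statistic $\mathsf{ddeg}$.
   Context: A finite lattice $L$ is semidistributive if for all $x\le y$ the set $\{z: z\wedge y=x\}$ has a unique maximal element and the set $\{z: z\vee x=y\}$ has a unique minimal element. $L$ has the $n$-switching property if the following hold. (1) Each element of $L$ is identified with a distinct lattice point $(x,y)$ with $x,y\ge 0$. (2) $(0,0),\dots,(0,n)\in L$, $(0,m)\notin L$ for $m>n$, and $(0,i-1)\lessdot(0,i)$ for $1\le i\le n$. (3) Every cover $(c_1,d_1)\lessdot(c_2,d_2)$ has $(c_2-c_1,d_2-d_1)\in\{(0,1)\}\cup\{(m,0):m\in\mathbb{Z}\}$. (4) $(c_1,d)\le(c_2,d)$ if and only if $c_1\le c_2$. For such $A$ and $m=0,\dots,n$, write $(a_m,m)_A$ for the rightmost element of $A$ on the line $y=m$; subscripts indicate which lattice a point belongs to. $A*B$ is the poset on the disjoint union $A\sqcup B$ whose cover relations $x\lessdot y$ are exactly the following: (i) $x\lessdot y$ in $A$; (ii) $x\lessdot y$ in $B$; (iii) $x=(a_m,m)_A$ and $y=(0,m)_B$ for some $m\in\{0,\dots,n\}$. Rowmotion on a finite semidistributive lattice $L$ is defined as follows. Let $\mathrm{Pop}^{\downarrow}(x)=x\wedge\bigwedge\{y:y\lessdot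 x\}$. Then $\mathrm{Row}(x)$ is the unique maximal element of $\{y: x\wedge y=\mathrm{Pop}^{\downarrow}(x)\}$. The orbit structure is the multiset of orbit sizes. $\mathsf{ddeg}(p)$ is the number of elements covered by $p$.
   Formalization: The n-switching property is taken to include that every element lies on a line y=m with 0≤m≤n; without this the claim fails (n=0, A the chain (0,0)<(1,0)<(1,1), B={(0,0)}: A*B has two maximal elements). *)

theory Defs
  imports
    "HOL-Algebra.Lattice"
    "HOL-Combinatorics.Orbits"
    "HOL-Library.Multiset"
begin

definition covered_by :: "('a, 'c) gorder_scheme \<Rightarrow> 'a \<Rightarrow> 'a \<Rightarrow> bool" where
  "covered_by L x y \<longleftrightarrow>
     x \<in> carrier L \<and> y \<in> carrier L \<and> x \<sqsubset>\<^bsub>L\<^esub> y \<and>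
     \<not> (\<exists>z\<in>carrier L. x \<sqsubset>\<^bsub>L\<^esub> z \<and> z \<sqsubset>\<^bsub>L\<^esub> y)"

definition maximal_in :: "('a, 'c) gorder_scheme \<Rightarrow> 'a set \<Rightarrow> 'a \<Rightarrow> bool" where
  "maximal_in L S z \<longleftrightarrow> z \<in> S \<and> \<not> (\<exists>w\<in>S. z \<sqsubset>\<^bsub>L\<^esub> w)"

definition minimal_in :: "('a, 'c) gorder_scheme \<Rightarrow> 'a set \<Rightarrow> 'a \<Rightarrow> bool" where
  "minimal_in L S z \<longleftrightarrow> z \<in> S \<and> \<not> (\<exists>w\<in>S. w \<sqsubset>\<^bsub>L\<^esub> z)"

definition finite_semidistributive_lattice :: "('a, 'c) gorder_scheme \<Rightarrow> bool" where
  "finite_semidistributive_lattice L \<longleftrightarrow>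
     finite (carrier L) \<and> lattice L \<and>
     (\<forall>x\<in>carrier L. \<forall>y\<in>carrier L. x \<sqsubseteq>\<^bsub>L\<^esub> y \<longrightarrow>
        (\<exists>!m. maximal_in L {z \<in> carrier L. z \<sqinter>\<^bsub>L\<^esub> y = x} m) \<and>
        (\<exists>!m. minimal_in L {z \<in> carrier L. z \<squnion>\<^bsub>L\<^esub> x = y} m))"

text \<open>
  The map \<open>pos\<close> is the identification of the elements of \<open>L\<close> with lattice points;
  \<open>(c, d) \<in> L\<close> is rendered as \<open>(c, d) \<in> pos ` carrier L\<close>.

  In the second clause, \<open>snd (pos x) \<le> n\<close> makes explicit the convention that \<open>L\<close> lives on
  the lines \<open>y = 0, \<dots>, n\<close>. Excluding only the points \<open>(0, m)\<close> with \<open>m > n\<close> would not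
  suffice: with \<open>n = 0\<close>, the chain \<open>(0,0) < (1,0) < (1,1)\<close> would be allowed, and its top
  element would have no upper bound in common with \<open>B\<close> in the poset \<open>A * B\<close> below.
\<close>
definition n_switching :: "nat \<Rightarrow> ('a, 'c) gorder_scheme \<Rightarrow> ('a \<Rightarrow> nat \<times> nat) \<Rightarrow> bool" where
  "n_switching n L pos \<longleftrightarrow>
     inj_on pos (carrier L) \<and>
     ((\<forall>i\<le>n. (0, i) \<in> pos ` carrier L) \<and>
      (\<forall>m>n. (0, m) \<notin> pos ` carrier L) \<and>
      (\<forall>x\<in>carrier L. snd (pos x) \<le> n) \<and>
      (\<forall>i\<in>{1..n}. \<forall>x\<in>carrier L. \<forall>y\<in>carrier L.
         pos x = (0, i - 1) \<and> pos y = (0, i) \<longrightarrow> covered_by L x y)) \<and>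
     (\<forall>x y c\<^sub>1 d\<^sub>1 c\<^sub>2 d\<^sub>2.
        covered_by L x y \<and> pos x = (c\<^sub>1, d\<^sub>1) \<and> pos y = (c\<^sub>2, d\<^sub>2) \<longrightarrow>
        (int c\<^sub>2 - int c\<^sub>1, int d\<^sub>2 - int d\<^sub>1) \<in> {(0, 1)} \<union> {(m, 0) | m. True}) \<and>
     (\<forall>x\<in>carrier L. \<forall>y\<in>carrier L. \<forall>c\<^sub>1 c\<^sub>2 d.
        pos x = (c\<^sub>1, d) \<and> pos y = (c\<^sub>2, d) \<longrightarrow> (x \<sqsubseteq>\<^bsub>L\<^esub> y \<longleftrightarrow> c\<^sub>1 \<le> c\<^sub>2))"

text \<open>\<open>rightmost L pos m x\<close>: \<open>x\<close> is the element \<open>(a\<^sub>m, m)\<close> of \<open>L\<close>.\<close>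
definition rightmost ::
  "('a, 'c) gorder_scheme \<Rightarrow> ('a \<Rightarrow> nat \<times> nat) \<Rightarrow> nat \<Rightarrow> 'a \<Rightarrow> bool" where
  "rightmost L pos m x \<longleftrightarrow>
     x \<in> carrier L \<and> snd (pos x) = m \<and>
     (\<forall>z\<in>carrier L. snd (pos z) = m \<longrightarrow> fst (pos z) \<le> fst (pos x))"

inductive star_cover ::
  "nat \<Rightarrow> ('a, 'c) gorder_scheme \<Rightarrow> ('a \<Rightarrow> nat \<times> nat) \<Rightarrow>
   ('b, 'd) gorder_scheme \<Rightarrow> ('b \<Rightarrow> nat \<times> nat) \<Rightarrow> 'a + 'b \<Rightarrow> 'a + 'b \<Rightarrow> bool"
  for n A posA B posB where
  left: "covered_by A x y \<Longrightarrow> star_cover n A posA B posB (Inl x) (Inl y)"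
| right: "covered_by B x y \<Longrightarrow> star_cover n A posA B posB (Inr x) (Inr y)"
| switch: "m \<le> n \<Longrightarrow> rightmost A posA m x \<Longrightarrow> y \<in> carrier B \<Longrightarrow> posB y = (0, m) \<Longrightarrow>
    star_cover n A posA B posB (Inl x) (Inr y)"

text \<open>The poset \<open>A * B\<close>: a finite order is the reflexive transitive closure of its covers.\<close>
definition star_poset ::
  "nat \<Rightarrow> ('a, 'c) gorder_scheme \<Rightarrow> ('a \<Rightarrow> nat \<times> nat) \<Rightarrow>
   ('b, 'd) gorder_scheme \<Rightarrow> ('b \<Rightarrow> nat \<times> nat) \<Rightarrow> ('a + 'b) gorder" where
  "star_poset n A posA B posB =
     \<lparr>carrier = carrier A <+> carrier B, eq = (=), le = (star_cover n A posA B posB)\<^sup>*\<^sup>*\<rparr>"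

definition Pop_down :: "('a, 'c) gorder_scheme \<Rightarrow> 'a \<Rightarrow> 'a" where
  "Pop_down L x = x \<sqinter>\<^bsub>L\<^esub> (\<Sqinter>\<^bsub>L\<^esub> {y. covered_by L y x})"

definition Row :: "('a, 'c) gorder_scheme \<Rightarrow> 'a \<Rightarrow> 'a" where
  "Row L x = (THE m. maximal_in L {y \<in> carrier L. x \<sqinter>\<^bsub>L\<^esub> y = Pop_down L x} m)"

definition ddeg :: "('a, 'c) gorder_scheme \<Rightarrow> 'a \<Rightarrow> nat" where
  "ddeg L x = card {y. covered_by L y x}"

text \<open>
  \<open>orbit f x\<close> collects the iterates \<open>(f ^^ k) x\<close> with \<open>k > 0\<close>; since rowmotion permutes the
  carrier of a finite semidistributive lattice, this contains \<open>x\<close> there.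
\<close>
definition Row_orbits :: "('a, 'c) gorder_scheme \<Rightarrow> 'a set set" where
  "Row_orbits L = orbit (Row L) ` carrier L"

definition orbit_structure :: "('a, 'c) gorder_scheme \<Rightarrow> nat multiset" where
  "orbit_structure L = image_mset card (mset_set (Row_orbits L))"

end

theory Submission
  imports Defs
begin

text \<open>
  The level (second coordinate) is a lattice homomorphism from an \<open>n\<close>-switching lattice onto the
  chain \<open>0 < \<dots> < n\<close> whose fibres are chains; let \<open>b\<^sub>i\<close> and \<open>t\<^sub>i\<close> be the least and the greatest
  element of level \<open>i\<close>. Rowmotion sends \<open>b\<^sub>i\<close> to \<open>t\<^sub>i\<^sub>-\<^sub>1\<close>, with indices modulo \<open>n + 1\<close>, and no other
  element to any \<open>t\<^sub>j\<close>. In \<open>A * B\<close>, an element of \<open>A\<close> lies below an element of \<open>B\<close> iff its level is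
  at most that of the latter. Hence rowmotion on \<open>A * B\<close> agrees with rowmotion on \<open>A\<close> and on \<open>B\<close>,
  except that \<open>b\<^sub>i\<close> of either lattice is sent to \<open>t\<^sub>i\<^sub>-\<^sub>1\<close> of the other one. This description is symmetric
  in \<open>A\<close> and \<open>B\<close>, so rowmotion on \<open>B * A\<close> is the same map.
\<close>

section \<open>Finite posets and finite semidistributive lattices\<close>

text \<open>The map \<open>b\<close> is a left adjoint and \<open>t\<close> a right adjoint of the
  level, which is why the level preserves meets and joins. Monotonicity of \<open>t\<close> is not
  assumed; it follows because the greatest element lies on level \<open>n\<close>. Levels are chains
  and a cover raises the level by at most one, so an element has at most one lower cover on its own
  level and at most one on the level below. This makes \<open>Row\<close> computable by hand: if
  \<open>Pop_down\<close> of some \<open>x\<close> other than the \<open>b i\<close> were the meet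
  of \<open>x\<close> with some \<open>t m\<close>, the lower cover of \<open>x\<close> on the level
  below would fall under the one on its own level. Mixed pairs in \<open>A * B\<close> obey the same
  adjunctions: seen from \<open>A\<close>, an element of \<open>B\<close> on level \<open>i\<close>
  acts as \<open>t i\<close>; seen from \<open>B\<close>, an element of \<open>A\<close> acts as
  \<open>b i\<close>. Semidistributivity and rowmotion thus reduce to statements inside one factor.
  For down-degrees only the sums over orbits agree, and comparing them requires that rowmotion
  permute each orbit; so \<open>Row\<close> is shown to be injective on each factor and then on
  \<open>A * B\<close>.\<close>

locale finite_poset = partial_order L for L (structure) +
  assumes finite_carrier: "finite (carrier L)"
begin

lemma strict_irrefl: "\<not> x \<sqsubset> x"
  by (simp add: lless_eq)

lemma strict_trans:
  assumes "x \<sqsubset> y" "y \<sqsubset> z" "x \<in> carrier L" "y \<in> carrier L" "z \<in> carrier L"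
  shows "x \<sqsubset> z"
  using assms by (meson lless_trans)

lemma ex_maximal_in:
  assumes "S \<subseteq> carrier L" "S \<noteq> {}"
  shows "\<exists>m. maximal_in L S m"
proof -
  have "finite S" using assms(1) finite_carrier finite_subset by blast
  moreover have "transp_on S (\<sqsubset>)"
    by (rule transp_onI) (use assms(1) strict_trans in \<open>meson subsetD\<close>)
  moreover have "asymp_on S (\<sqsubset>)"
    by (rule asymp_onI) (use assms(1) strict_irrefl strict_trans in \<open>meson subsetD\<close>)
  ultimately obtain m where "m \<in> S" "\<forall>x\<in>S. x \<noteq> m \<longrightarrow> \<not> m \<sqsubset> x"
    using Finite_Set.bex_max_element[of S "(\<sqsubset>)"] assms(2) by blast
  then have "maximal_in L S m" using strict_irrefl unfolding maximal_in_def by metis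
  then show ?thesis ..
qed

lemma ex_minimal_in:
  assumes "S \<subseteq> carrier L" "S \<noteq> {}"
  shows "\<exists>m. minimal_in L S m"
proof -
  have "finite S" using assms(1) finite_carrier finite_subset by blast
  moreover have "transp_on S (\<sqsubset>)"
    by (rule transp_onI) (use assms(1) strict_trans in \<open>meson subsetD\<close>)
  moreover have "asymp_on S (\<sqsubset>)"
    by (rule asymp_onI) (use assms(1) strict_irrefl strict_trans in \<open>meson subsetD\<close>)
  ultimately obtain m where "m \<in> S" "\<forall>x\<in>S. x \<noteq> m \<longrightarrow> \<not> x \<sqsubset> m"
    using Finite_Set.bex_min_element[of S "(\<sqsubset>)"] assms(2) by blast
  then have "minimal_in L S m" using strict_irrefl unfolding minimal_in_def by metis
  then show ?thesis ..
qed

text \<open>Finiteness puts a maximal element of \<open>S\<close> above every \<open>y\<close> in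
  \<open>S\<close>, so a unique maximal element is a greatest one. The uniqueness clauses of
  semidistributivity are used through this inequality.\<close>

lemma unique_maximal_greatest:
  assumes S: "S \<subseteq> carrier L" and ex1: "\<exists>!m. maximal_in L S m"
    and m: "maximal_in L S m" and y: "y \<in> S"
  shows "y \<sqsubseteq> m"
proof -
  obtain z where z: "maximal_in L {w \<in> S. y \<sqsubseteq> w} z"
    using ex_maximal_in[of "{w \<in> S. y \<sqsubseteq> w}"] S y by blast
  have "maximal_in L S z"
    unfolding maximal_in_def
  proof (intro conjI notI)
    show "z \<in> S" using z unfolding maximal_in_def by blast
    assume "\<exists>w\<in>S. z \<sqsubset> w"
    then obtain w where w: "w \<in> S" "z \<sqsubset> w" by blast
    have "y \<sqsubseteq> z" "z \<in> S" using z unfolding maximal_in_def by blast+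
    then have "y \<sqsubseteq> w"
      using w S y by (intro le_trans[of y z w]) (auto simp: lless_eq)
    then show False using z w unfolding maximal_in_def by blast
  qed
  then have "z = m" using ex1 m by blast
  then show ?thesis using z unfolding maximal_in_def by blast
qed

lemma unique_minimal_least:
  assumes S: "S \<subseteq> carrier L" and ex1: "\<exists>!m. minimal_in L S m"
    and m: "minimal_in L S m" and y: "y \<in> S"
  shows "m \<sqsubseteq> y"
proof -
  obtain z where z: "minimal_in L {w \<in> S. w \<sqsubseteq> y} z"
    using ex_minimal_in[of "{w \<in> S. w \<sqsubseteq> y}"] S y by blast
  have "minimal_in L S z"
    unfolding minimal_in_def
  proof (intro conjI notI)
    show "z \<in> S" using z unfolding minimal_in_def by blast
    assume "\<exists>w\<in>S. w \<sqsubset> z"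
    then obtain w where w: "w \<in> S" "w \<sqsubset> z" by blast
    have "z \<sqsubseteq> y" "z \<in> S" using z unfolding minimal_in_def by blast+
    then have "w \<sqsubseteq> y"
      using w S y by (intro le_trans[of w z y]) (auto simp: lless_eq)
    then show False using z w unfolding minimal_in_def by blast
  qed
  then have "z = m" using ex1 m by blast
  then show ?thesis using z unfolding minimal_in_def by blast
qed

lemma ex_cover_above:
  assumes "x \<in> carrier L" "y \<in> carrier L" "x \<sqsubset> y"
  obtains c where "covered_by L x c" "c \<sqsubseteq> y"
proof -
  obtain c where c: "minimal_in L {z \<in> carrier L. x \<sqsubset> z \<and> z \<sqsubseteq> y} c"
    using ex_minimal_in[of "{z \<in> carrier L. x \<sqsubset> z \<and> z \<sqsubseteq> y}"] assms by blast
  have "\<not> (x \<sqsubset> z \<and> z \<sqsubset> c)" if "z \<in> carrier L" for z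
  proof
    assume z: "x \<sqsubset> z \<and> z \<sqsubset> c"
    then have "z \<sqsubseteq> y"
      using c that assms by (intro le_trans[of z c y]) (auto simp: minimal_in_def lless_eq)
    then show False using c z that unfolding minimal_in_def by blast
  qed
  then have "covered_by L x c"
    using c assms unfolding covered_by_def minimal_in_def by blast
  then show ?thesis using c that unfolding minimal_in_def by blast
qed

lemma ex_cover_below:
  assumes "x \<in> carrier L" "y \<in> carrier L" "x \<sqsubset> y"
  obtains c where "covered_by L c y" "x \<sqsubseteq> c"
proof -
  obtain c where c: "maximal_in L {z \<in> carrier L. x \<sqsubseteq> z \<and> z \<sqsubset> y} c"
    using ex_maximal_in[of "{z \<in> carrier L. x \<sqsubseteq> z \<and> z \<sqsubset> y}"] assms by blast
  have "\<not> (c \<sqsubset> z \<and> z \<sqsubset> y)" if "z \<in> carrier L" for z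
  proof
    assume z: "c \<sqsubset> z \<and> z \<sqsubset> y"
    then have "x \<sqsubseteq> z"
      using c that assms by (intro le_trans[of x c z]) (auto simp: maximal_in_def lless_eq)
    then show False using c z that unfolding maximal_in_def by blast
  qed
  then have "covered_by L c y"
    using c assms unfolding covered_by_def maximal_in_def by blast
  then show ?thesis using c that unfolding maximal_in_def by blast
qed

text \<open>Bounds on level changes and the order of \<open>star_poset\<close> are given through
  covers; this links them with the order of a single factor. The number of elements strictly above
  \<open>x\<close> drops along each cover.\<close>

lemma le_imp_covers:
  assumes "x \<in> carrier L" "y \<in> carrier L" "x \<sqsubseteq> y"
  shows "(covered_by L)\<^sup>*\<^sup>* x y"
  using assms
proof (induction "card {z \<in> carrier L. x \<sqsubset> z}" arbitrary: x rule: less_induct)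
  case less
  show ?case
  proof (cases "x = y")
    case False
    then obtain c where c: "covered_by L x c" "c \<sqsubseteq> y"
      using less.prems ex_cover_above by (metis lless_eq)
    then have cC: "c \<in> carrier L" "x \<sqsubset> c" by (auto simp: covered_by_def)
    have "{z \<in> carrier L. c \<sqsubset> z} \<subset> {z \<in> carrier L. x \<sqsubset> z}"
      using cC less.prems(1) strict_trans strict_irrefl by blast
    then have "card {z \<in> carrier L. c \<sqsubset> z} < card {z \<in> carrier L. x \<sqsubset> z}"
      using finite_carrier by (intro psubset_card_mono) auto
    then have "(covered_by L)\<^sup>*\<^sup>* c y" using less c cC by blast
    then show ?thesis using c by (meson converse_rtranclp_into_rtranclp)
  qed simp
qed

end

section \<open>Recognising meets, joins, \<open>Pop_down\<close> and \<open>Row\<close>\<close>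

context lattice
begin

lemma meet_glb: "\<lbrakk>x \<in> carrier L; y \<in> carrier L; z \<in> carrier L\<rbrakk> \<Longrightarrow>
    z \<sqsubseteq> x \<sqinter> y \<longleftrightarrow> z \<sqsubseteq> x \<and> z \<sqsubseteq> y"
  by (meson le_trans meet_closed meet_le meet_left meet_right)

lemma join_lub: "\<lbrakk>x \<in> carrier L; y \<in> carrier L; z \<in> carrier L\<rbrakk> \<Longrightarrow>
    x \<squnion> y \<sqsubseteq> z \<longleftrightarrow> x \<sqsubseteq> z \<and> y \<sqsubseteq> z"
  by (meson le_trans join_closed join_le join_left join_right)

lemma meet_eqI:
  assumes "x \<in> carrier L" "y \<in> carrier L" "m \<in> carrier L" "m \<sqsubseteq> x" "m \<sqsubseteq> y"
    "\<And>z. z \<in> carrier L \<Longrightarrow> z \<sqsubseteq> x \<Longrightarrow> z \<sqsubseteq> y \<Longrightarrow> z \<sqsubseteq> m"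
  shows "x \<sqinter> y = m"
  using assms by (intro le_antisym) (auto simp: meet_left meet_right meet_le)

lemma join_eqI:
  assumes "x \<in> carrier L" "y \<in> carrier L" "m \<in> carrier L" "x \<sqsubseteq> m" "y \<sqsubseteq> m"
    "\<And>z. z \<in> carrier L \<Longrightarrow> x \<sqsubseteq> z \<Longrightarrow> y \<sqsubseteq> z \<Longrightarrow> m \<sqsubseteq> z"
  shows "x \<squnion> y = m"
  using assms by (intro le_antisym) (auto simp: join_left join_right join_le)

text \<open>If \<open>x\<close> has no lower covers, the infimum inside \<open>Pop_down\<close> is
  that of the empty set, namely the greatest element; this is where \<open>T\<close> enters. Meeting
  with \<open>x\<close> then gives \<open>x\<close> itself.\<close>

lemma Pop_down_eqI:
  assumes x: "x \<in> carrier L" and p: "p \<in> carrier L" "p \<sqsubseteq> x"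
    and lb: "\<And>c. covered_by L c x \<Longrightarrow> p \<sqsubseteq> c"
    and glb: "\<And>z. z \<in> carrier L \<Longrightarrow> z \<sqsubseteq> x \<Longrightarrow> (\<And>c. covered_by L c x \<Longrightarrow> z \<sqsubseteq> c) \<Longrightarrow> z \<sqsubseteq> p"
    and top: "T \<in> carrier L" "\<And>z. z \<in> carrier L \<Longrightarrow> z \<sqsubseteq> T"
  shows "Pop_down L x = p"
proof (cases "{c. covered_by L c x} = {}")
  case True
  have "greatest L T (Lower L {})"
    using top by (simp add: greatest_def)
  then have "\<Sqinter> {} = T"
    unfolding Lattice.inf_def by (intro some_equality) (blast intro: greatest_unique)+
  moreover have "p = x"
    using True glb[of x] x p le_antisym by blast
  ultimately show ?thesis
    unfolding Pop_down_def True using x top p by (simp, intro meet_eqI) auto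
next
  case False
  have le: "z \<sqsubseteq> p" if "z \<in> carrier L" "\<And>c. covered_by L c x \<Longrightarrow> z \<sqsubseteq> c" for z
  proof -
    obtain c where "covered_by L c x" using False by blast
    then have "c \<in> carrier L" "c \<sqsubseteq> x" "z \<sqsubseteq> c"
      using that by (auto simp: covered_by_def lless_eq)
    then have "z \<sqsubseteq> x" using le_trans[of z c x] that(1) x by simp
    then show ?thesis by (rule glb[OF that(1)]) (rule that(2))
  qed
  have "greatest L p (Lower L {c. covered_by L c x})"
  proof (rule greatest_LowerI)
    show "p \<sqsubseteq> c" if "c \<in> {c. covered_by L c x}" for c using that lb by blast
    show "y \<sqsubseteq> p" if "y \<in> Lower L {c. covered_by L c x}" for y
    proof (rule le)
      show "y \<in> carrier L" using that by (rule subsetD[OF Lower_closed])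
      show "y \<sqsubseteq> c" if "covered_by L c x" for c
        using that \<open>y \<in> Lower L _\<close> by (auto simp: Lower_def covered_by_def)
    qed
    show "{c. covered_by L c x} \<subseteq> carrier L" by (auto simp: covered_by_def)
  qed (use p in simp)
  then have "\<Sqinter> {c. covered_by L c x} = p"
    unfolding Lattice.inf_def by (intro some_equality) (blast intro: greatest_unique)+
  then show ?thesis
    unfolding Pop_down_def using x p by (simp, intro meet_eqI) auto
qed

lemma Row_eqI:
  assumes "r \<in> carrier L" "x \<sqinter> r = Pop_down L x"
    and "\<And>z. z \<in> carrier L \<Longrightarrow> x \<sqinter> z = Pop_down L x \<Longrightarrow> z \<sqsubseteq> r"
  shows "Row L x = r"
  unfolding Row_def
proof (rule the_equality)
  show "maximal_in L {y \<in> carrier L. x \<sqinter> y = Pop_down L x} r"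
    using assms le_antisym unfolding maximal_in_def lless_eq by blast
  show "m = r" if "maximal_in L {y \<in> carrier L. x \<sqinter> y = Pop_down L x} m" for m
    using that assms unfolding maximal_in_def lless_eq by blast
qed

end

text \<open>The implications close the first solution set under joins and the second under meets.
  Two maximal elements then both equal their join, and two minimal ones their meet.\<close>

lemma (in finite_poset) finite_semidistributive_latticeI:
  assumes lat: "lattice L"
    and sdm: "\<And>x y z w. \<lbrakk>z \<in> carrier L; w \<in> carrier L; x \<in> carrier L; y \<in> carrier L;
      z \<sqinter> y = x; w \<sqinter> y = x\<rbrakk> \<Longrightarrow> (z \<squnion> w) \<sqinter> y = x"
    and sdj: "\<And>x y z w. \<lbrakk>z \<in> carrier L; w \<in> carrier L; x \<in> carrier L; y \<in> carrier L;
      z \<squnion> x = y; w \<squnion> x = y\<rbrakk> \<Longrightarrow> (z \<sqinter> w) \<squnion> x = y"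
  shows "finite_semidistributive_lattice L"
  unfolding finite_semidistributive_lattice_def
proof (intro conjI ballI impI)
  interpret lattice L by (fact lat)
  fix x y assume xy: "x \<in> carrier L" "y \<in> carrier L" "x \<sqsubseteq> y"
  let ?S = "{z \<in> carrier L. z \<sqinter> y = x}"
  have "x \<in> ?S" using xy by (simp add: meet_eqI)
  then obtain m where m: "maximal_in L ?S m" using ex_maximal_in[of ?S] by blast
  have "m' = m" if m': "maximal_in L ?S m'" for m'
  proof -
    have C: "m \<in> carrier L" "m' \<in> carrier L" using m m' by (auto simp: maximal_in_def)
    have "m \<squnion> m' \<in> ?S"
      using m m' xy sdm[of m m' x y] by (auto simp: maximal_in_def)
    then have "m = m \<squnion> m'" "m' = m \<squnion> m'"
      using C join_left[OF C] join_right[OF C] m m' unfolding maximal_in_def lless_eq by blast+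
    then show ?thesis by simp
  qed
  then show "\<exists>!m. maximal_in L ?S m" using m by blast
  let ?T = "{z \<in> carrier L. z \<squnion> x = y}"
  have "y \<in> ?T" using xy by (simp add: join_eqI)
  then obtain k where k: "minimal_in L ?T k" using ex_minimal_in[of ?T] by blast
  have "k' = k" if k': "minimal_in L ?T k'" for k'
  proof -
    have C: "k \<in> carrier L" "k' \<in> carrier L" using k k' by (auto simp: minimal_in_def)
    have "k \<sqinter> k' \<in> ?T"
      using k k' xy sdj[of k k' x y] by (auto simp: minimal_in_def)
    then have "k = k \<sqinter> k'" "k' = k \<sqinter> k'"
      using C meet_left[OF C] meet_right[OF C] k k' unfolding minimal_in_def lless_eq by metis+
    then show ?thesis by simp
  qed
  then show "\<exists>!m. minimal_in L ?T m" using k by blast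
qed (fact finite_carrier lat)+

section \<open>Semidistributive laws and the values of rowmotion\<close>

locale semidistributive_lattice = lattice L for L (structure) +
  assumes semidistributive: "finite_semidistributive_lattice L"
begin

sublocale finite_poset
  using semidistributive by unfold_locales (simp add: finite_semidistributive_lattice_def)

lemma ex1_maximal_meet:
  assumes "x \<in> carrier L" "y \<in> carrier L" "x \<sqsubseteq> y"
  shows "\<exists>!m. maximal_in L {z \<in> carrier L. z \<sqinter> y = x} m"
  using semidistributive assms by (simp add: finite_semidistributive_lattice_def)

lemma ex1_minimal_join:
  assumes "x \<in> carrier L" "y \<in> carrier L" "x \<sqsubseteq> y"
  shows "\<exists>!m. minimal_in L {z \<in> carrier L. z \<squnion> x = y} m"
  using semidistributive assms by (simp add: finite_semidistributive_lattice_def)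

text \<open>Among all elements having this meet with \<open>y\<close> there is a greatest one,
  \<open>m\<close>. The join of \<open>z\<close> and \<open>w\<close> lies between \<open>z\<close>
  and \<open>m\<close>, so its meet with \<open>y\<close> is squeezed between two equal
  meets.\<close>

lemma meet_semidistributive:
  assumes C: "z \<in> carrier L" "w \<in> carrier L" "y \<in> carrier L" and eq: "z \<sqinter> y = w \<sqinter> y"
  shows "(z \<squnion> w) \<sqinter> y = z \<sqinter> y"
proof -
  let ?S = "{v \<in> carrier L. v \<sqinter> y = z \<sqinter> y}"
  have ex1: "\<exists>!m. maximal_in L ?S m"
    using C by (intro ex1_maximal_meet meet_closed meet_right)
  then obtain m where m: "maximal_in L ?S m" by blast
  then have mS: "m \<in> carrier L" "m \<sqinter> y = z \<sqinter> y" by (auto simp: maximal_in_def)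
  have "z \<sqsubseteq> m" "w \<sqsubseteq> m"
    using unique_maximal_greatest[OF _ ex1 m] C eq by auto
  then have jm: "z \<squnion> w \<sqsubseteq> m" using C mS by (simp add: join_le)
  have jC: "z \<squnion> w \<in> carrier L" using C by simp
  have le: "v \<sqsubseteq> z \<sqinter> y" if "v \<in> carrier L" "v \<sqsubseteq> z \<squnion> w" "v \<sqsubseteq> y" for v
  proof -
    have "v \<sqsubseteq> m" by (rule le_trans[OF that(2) jm that(1) jC mS(1)])
    then have "v \<sqsubseteq> m \<sqinter> y" using that mS(1) C by (simp add: meet_le)
    then show ?thesis unfolding mS(2) .
  qed
  have "z \<sqinter> y \<sqsubseteq> z \<squnion> w"
    using C jC by (intro le_trans[OF meet_left join_left]) simp_all
  then show ?thesis
    by (rule meet_eqI[OF jC C(3) meet_closed[OF C(1,3)] _ meet_right[OF C(1,3)] le])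
qed

lemma join_semidistributive:
  assumes C: "z \<in> carrier L" "w \<in> carrier L" "x \<in> carrier L" and eq: "z \<squnion> x = w \<squnion> x"
  shows "(z \<sqinter> w) \<squnion> x = z \<squnion> x"
proof -
  let ?S = "{v \<in> carrier L. v \<squnion> x = z \<squnion> x}"
  have ex1: "\<exists>!m. minimal_in L ?S m"
    using C by (intro ex1_minimal_join join_closed join_right)
  then obtain m where m: "minimal_in L ?S m" by blast
  then have mS: "m \<in> carrier L" "m \<squnion> x = z \<squnion> x" by (auto simp: minimal_in_def)
  have "m \<sqsubseteq> z" "m \<sqsubseteq> w"
    using unique_minimal_least[OF _ ex1 m] C eq by auto
  then have jm: "m \<sqsubseteq> z \<sqinter> w" using C mS by (simp add: meet_le)
  have jC: "z \<sqinter> w \<in> carrier L" using C by simp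
  have le: "z \<squnion> x \<sqsubseteq> v" if "v \<in> carrier L" "z \<sqinter> w \<sqsubseteq> v" "x \<sqsubseteq> v" for v
  proof -
    have "m \<sqsubseteq> v" by (rule le_trans[OF jm that(2) mS(1) jC that(1)])
    then have "m \<squnion> x \<sqsubseteq> v" using that mS(1) C by (simp add: join_le)
    then show ?thesis unfolding mS(2) .
  qed
  have "z \<sqinter> w \<sqsubseteq> z \<squnion> x"
    using C jC by (intro le_trans[OF meet_left join_left]) simp_all
  then show ?thesis
    by (rule join_eqI[OF jC C(3) join_closed[OF C(1,3)] _ join_right[OF C(1,3)] le])
qed

lemma ex_greatest:
  assumes "x \<in> carrier L"
  obtains T where "T \<in> carrier L" "\<And>z. z \<in> carrier L \<Longrightarrow> z \<sqsubseteq> T"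
proof -
  obtain T where T: "maximal_in L (carrier L) T" using ex_maximal_in[of "carrier L"] assms by blast
  then have TC: "T \<in> carrier L" by (simp add: maximal_in_def)
  have "z \<sqsubseteq> T" if z: "z \<in> carrier L" for z
  proof -
    have "T = T \<squnion> z"
      using T TC z join_left[OF TC z] unfolding maximal_in_def lless_eq by auto
    then show ?thesis using join_right[OF TC z] by simp
  qed
  then show ?thesis using that TC by blast
qed

lemma Pop_down:
  assumes x: "x \<in> carrier L"
  shows "Pop_down L x \<in> carrier L" "Pop_down L x \<sqsubseteq> x"
    "\<And>c. covered_by L c x \<Longrightarrow> Pop_down L x \<sqsubseteq> c"
    "\<And>z. \<lbrakk>z \<in> carrier L; z \<sqsubseteq> x; \<And>c. covered_by L c x \<Longrightarrow> z \<sqsubseteq> c\<rbrakk> \<Longrightarrow> z \<sqsubseteq> Pop_down L x"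
proof -
  obtain T where T: "T \<in> carrier L" "\<And>z. z \<in> carrier L \<Longrightarrow> z \<sqsubseteq> T" using ex_greatest x by blast
  \<comment> \<open>Including \<open>x\<close> keeps the set nonempty even for the least element, so
    that \<open>finite_inf_greatest\<close> applies uniformly.\<close>
  define S where "S = insert x {c. covered_by L c x}"
  have S: "S \<subseteq> carrier L" "S \<noteq> {}" using x by (auto simp: S_def covered_by_def)
  have "finite S" by (rule finite_subset[OF S(1) finite_carrier])
  then have g: "greatest L (\<Sqinter> S) (Lower L S)" by (rule finite_inf_greatest[OF _ S])
  have p: "\<Sqinter> S \<in> carrier L" by (rule greatest_closed[OF g])
  have p_x: "\<Sqinter> S \<sqsubseteq> x" by (rule greatest_Lower_below[OF g _ S(1)]) (simp add: S_def)
  have p_c: "\<Sqinter> S \<sqsubseteq> c" if "covered_by L c x" for c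
    by (rule greatest_Lower_below[OF g _ S(1)]) (simp add: S_def that)
  have p_le: "z \<sqsubseteq> \<Sqinter> S"
    if "z \<in> carrier L" "z \<sqsubseteq> x" "\<And>c. covered_by L c x \<Longrightarrow> z \<sqsubseteq> c" for z
    by (rule greatest_le[OF g], rule Lower_memI) (use that in \<open>auto simp: S_def\<close>)
  have eq: "Pop_down L x = \<Sqinter> S"
    by (rule Pop_down_eqI[OF x p p_x p_c p_le T])
  show "Pop_down L x \<in> carrier L" "Pop_down L x \<sqsubseteq> x" unfolding eq by (fact p p_x)+
  show "Pop_down L x \<sqsubseteq> c" if "covered_by L c x" for c unfolding eq using that by (rule p_c)
  show "z \<sqsubseteq> Pop_down L x"
    if "z \<in> carrier L" "z \<sqsubseteq> x" "\<And>c. covered_by L c x \<Longrightarrow> z \<sqsubseteq> c" for z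
    unfolding eq using that by (rule p_le)
qed

lemma Row:
  assumes x: "x \<in> carrier L"
  shows "Row L x \<in> carrier L" "x \<sqinter> Row L x = Pop_down L x"
    "\<And>z. \<lbrakk>z \<in> carrier L; x \<sqinter> z = Pop_down L x\<rbrakk> \<Longrightarrow> z \<sqsubseteq> Row L x"
proof -
  let ?S = "{z \<in> carrier L. x \<sqinter> z = Pop_down L x}"
  have "?S = {z \<in> carrier L. z \<sqinter> x = Pop_down L x}" by (simp add: meet_comm)
  then have ex1: "\<exists>!m. maximal_in L ?S m"
    using ex1_maximal_meet[OF Pop_down(1)[OF x] x Pop_down(2)[OF x]] by simp
  then have m: "maximal_in L ?S (Row L x)" unfolding Row_def by (rule theI')
  then show "Row L x \<in> carrier L" "x \<sqinter> Row L x = Pop_down L x" by (auto simp: maximal_in_def)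
  show "\<And>z. \<lbrakk>z \<in> carrier L; x \<sqinter> z = Pop_down L x\<rbrakk> \<Longrightarrow> z \<sqsubseteq> Row L x"
    using unique_maximal_greatest[OF _ ex1 m] by blast
qed

end

section \<open>Rowmotion on lattices with chains as levels\<close>

definition prev_level :: "nat \<Rightarrow> nat \<Rightarrow> nat" where
  "prev_level n i = (if i = 0 then n else i - 1)"

lemma prev_level_le: "i \<le> n \<Longrightarrow> prev_level n i \<le> n"
  by (auto simp: prev_level_def)

lemma prev_level_inj: "\<lbrakk>i \<le> n; j \<le> n; prev_level n i = prev_level n j\<rbrakk> \<Longrightarrow> i = j"
  by (auto simp: prev_level_def split: if_splits)

text \<open>An abstraction of one switching lattice that forgets the horizontal coordinate.
  \<open>b_le_iff\<close> and \<open>le_t_iff\<close> are adjunctions with \<open>h\<close>: the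
  first yields \<open>h_meet\<close>, the second \<open>h_join\<close>.\<close>

locale levelled_lattice = semidistributive_lattice L for L (structure) +
  fixes n :: nat and h :: "'a \<Rightarrow> nat" and b t :: "nat \<Rightarrow> 'a"
  assumes b_closed: "i \<le> n \<Longrightarrow> b i \<in> carrier L" and t_closed: "i \<le> n \<Longrightarrow> t i \<in> carrier L"
    and h_b: "i \<le> n \<Longrightarrow> h (b i) = i" and h_t: "i \<le> n \<Longrightarrow> h (t i) = i"
    and h_le_n: "x \<in> carrier L \<Longrightarrow> h x \<le> n"
    and le_t_iff: "\<lbrakk>x \<in> carrier L; i \<le> n\<rbrakk> \<Longrightarrow> x \<sqsubseteq> t i \<longleftrightarrow> h x \<le> i"
    and b_le_iff: "\<lbrakk>x \<in> carrier L; i \<le> n\<rbrakk> \<Longrightarrow> b i \<sqsubseteq> x \<longleftrightarrow> i \<le> h x"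
    and level_chain: "\<lbrakk>x \<in> carrier L; y \<in> carrier L; h x = h y\<rbrakk> \<Longrightarrow> x \<sqsubseteq> y \<or> y \<sqsubseteq> x"
    and cover_level: "covered_by L x y \<Longrightarrow> h y \<le> Suc (h x)"
    and b_cover: "i < n \<Longrightarrow> covered_by L (b i) (b (Suc i))"
begin

section \<open>The level as a lattice homomorphism\<close>

lemma h_mono:
  assumes "x \<in> carrier L" "y \<in> carrier L" "x \<sqsubseteq> y"
  shows "h x \<le> h y"
proof -
  have "y \<sqsubseteq> t (h y)" using assms by (simp add: le_t_iff h_le_n)
  then have "x \<sqsubseteq> t (h y)"
    using le_trans[OF assms(3)] assms by (simp add: t_closed h_le_n)
  then show ?thesis using assms by (simp add: le_t_iff h_le_n)
qed

lemma h_meet: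
  assumes "x \<in> carrier L" "y \<in> carrier L"
  shows "h (x \<sqinter> y) = min (h x) (h y)"
proof (rule antisym)
  show "h (x \<sqinter> y) \<le> min (h x) (h y)"
    using assms by (simp add: h_mono meet_left meet_right)
  have "b (min (h x) (h y)) \<sqsubseteq> x \<sqinter> y"
    using assms by (intro meet_le) (simp_all add: b_le_iff b_closed h_le_n min.coboundedI1)
  then show "min (h x) (h y) \<le> h (x \<sqinter> y)"
    using assms by (subst (asm) b_le_iff) (simp_all add: h_le_n min.coboundedI1)
qed

lemma h_join:
  assumes "x \<in> carrier L" "y \<in> carrier L"
  shows "h (x \<squnion> y) = max (h x) (h y)"
proof (rule antisym)
  show "max (h x) (h y) \<le> h (x \<squnion> y)"
    using assms by (simp add: h_mono join_left join_right)
  have "x \<squnion> y \<sqsubseteq> t (max (h x) (h y))"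
    using assms by (intro join_le) (simp_all add: le_t_iff t_closed h_le_n)
  then show "h (x \<squnion> y) \<le> max (h x) (h y)"
    using assms by (subst (asm) le_t_iff) (simp_all add: h_le_n)
qed

lemma covered_byD:
  assumes "covered_by L x y"
  shows "x \<in> carrier L" "y \<in> carrier L" "x \<sqsubseteq> y" "x \<noteq> y" "h x \<le> h y" "h y \<le> Suc (h x)"
    "\<And>z. \<lbrakk>z \<in> carrier L; x \<sqsubseteq> z; z \<sqsubseteq> y\<rbrakk> \<Longrightarrow> z = x \<or> z = y"
  using assms h_mono cover_level by (auto simp: covered_by_def lless_eq)

text \<open>Distinct covers of one element are incomparable, whereas a level is a chain. With
  \<open>cover_level\<close> this leaves at most two lower covers, one on the level of
  \<open>x\<close> and one on the level below; the next lemma gives the same bound for upper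
  covers.\<close>

lemma lower_covers_same_level:
  assumes "covered_by L c x" "covered_by L d x" "h c = h d"
  shows "c = d"
  using covered_byD[OF assms(1)] covered_byD[OF assms(2)] level_chain[of c d] assms(3) by metis

lemma upper_covers_same_level:
  assumes "covered_by L x c" "covered_by L x d" "h c = h d"
  shows "c = d"
  using covered_byD[OF assms(1)] covered_byD[OF assms(2)] level_chain[of c d] assms(3) by metis

section \<open>Rowmotion and the extreme elements of the levels\<close>

lemma b_0_le: "x \<in> carrier L \<Longrightarrow> b 0 \<sqsubseteq> x"
  by (simp add: b_le_iff)

text \<open>Since \<open>b (Suc j)\<close> is least on its level, a lower cover has level
  \<open>j\<close>. It therefore lies between \<open>b j\<close> and \<open>b (Suc j)\<close>, which
  form a cover themselves.\<close>

lemma lower_cover_b_Suc: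
  assumes "Suc j \<le> n" "covered_by L c (b (Suc j))"
  shows "c = b j"
proof -
  note c = covered_byD[OF assms(2)]
  have "h c \<noteq> Suc j"
    using c(1,3,4) assms(1) b_le_iff[of c "Suc j"] le_antisym b_closed by auto
  then have "b j \<sqsubseteq> c"
    using c(1,6) assms(1) by (simp add: b_le_iff h_b)
  then show ?thesis
    using covered_byD(7)[OF b_cover[of j], of c] c assms(1) by auto
qed

text \<open>For the least element \<open>b 0\<close> every element solves the defining equation, and
  the greatest of all is \<open>t n\<close>. For \<open>b (Suc j)\<close>, \<open>Pop_down\<close>
  is its only lower cover \<open>b j\<close>; comparing levels forces a solution onto level
  \<open>j\<close>, and \<open>t j\<close> is one.\<close>

lemma Row_b:
  assumes "i \<le> n"
  shows "Row L (b i) = t (prev_level n i)"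
proof (cases i)
  case 0
  have b0: "b 0 \<in> carrier L" by (simp add: b_closed)
  have "Pop_down L (b 0) = b 0"
    using Pop_down(1,2)[OF b0] b_0_le b0 le_antisym by blast
  moreover have "b 0 \<sqinter> t n = b 0"
    using b0 by (intro meet_eqI) (simp_all add: t_closed le_t_iff h_le_n)
  ultimately have "Row L (b 0) = t n"
    by (intro Row_eqI) (simp_all add: t_closed le_t_iff h_le_n)
  then show ?thesis using 0 by (simp add: prev_level_def)
next
  case (Suc j)
  then have j: "Suc j \<le> n" using assms by simp
  then have C: "b (Suc j) \<in> carrier L" "b j \<in> carrier L" "t j \<in> carrier L"
    by (simp_all add: b_closed t_closed)
  have cov: "covered_by L (b j) (b (Suc j))" using j b_cover by simp
  have "b j \<sqsubseteq> Pop_down L (b (Suc j))"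
    by (rule Pop_down(4)[OF C(1,2) covered_byD(3)[OF cov]])
      (use lower_cover_b_Suc[OF j] C in blast)
  then have Pop: "Pop_down L (b (Suc j)) = b j"
    using Pop_down(1,3)[OF C(1)] cov C le_antisym by blast
  have "z \<sqsubseteq> b j" if z: "z \<in> carrier L" "z \<sqsubseteq> b (Suc j)" "z \<sqsubseteq> t j" for z
  proof -
    have "h z \<le> j" using z j by (simp add: le_t_iff)
    then have "z \<sqsubset> b (Suc j)" using z j by (auto simp: lless_eq h_b)
    then show ?thesis
      using ex_cover_below[OF z(1) C(1)] lower_cover_b_Suc[OF j] by metis
  qed
  moreover have "b j \<sqsubseteq> t j" using C j by (simp add: le_t_iff h_b)
  ultimately have meet: "b (Suc j) \<sqinter> t j = b j"
    using C covered_byD(3)[OF cov] by (intro meet_eqI)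
  have "Row L (b (Suc j)) = t j"
  proof (rule Row_eqI)
    fix z assume z: "z \<in> carrier L" "b (Suc j) \<sqinter> z = Pop_down L (b (Suc j))"
    then have "min (Suc j) (h z) = j"
      using h_meet[OF C(1) z(1)] Pop j by (simp add: h_b)
    then show "z \<sqsubseteq> t j" using z j by (simp add: le_t_iff min_def split: if_splits)
  qed (use C meet Pop in simp_all)
  then show ?thesis using Suc by (simp add: prev_level_def)
qed

lemma level_lower_cover:
  assumes "x \<in> carrier L" "x \<noteq> b (h x)"
  obtains c where "covered_by L c x" "h c = h x"
proof -
  have "b (h x) \<in> carrier L" "b (h x) \<sqsubset> x"
    using assms by (auto simp: lless_eq b_le_iff b_closed h_le_n)
  then obtain c where c: "covered_by L c x" "b (h x) \<sqsubseteq> c"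
    using ex_cover_below assms by blast
  then have "h c = h x"
    using covered_byD[OF c(1)] assms by (simp add: b_le_iff h_le_n)
  then show ?thesis using that c by blast
qed

text \<open>The element \<open>b i\<close> is a common lower bound of \<open>x\<close> and its lower
  covers. This bounds the level of \<open>Pop_down\<close> without computing it.\<close>

lemma level_Pop_down_ge:
  assumes "x \<in> carrier L" "i \<le> h x" "\<And>c. covered_by L c x \<Longrightarrow> i \<le> h c"
  shows "i \<le> h (Pop_down L x)"
proof -
  have i: "i \<le> n" using assms h_le_n[of x] by simp
  have "b i \<sqsubseteq> Pop_down L x"
    using assms i covered_byD(1) by (intro Pop_down(4)) (auto simp: b_closed b_le_iff)
  then show ?thesis using i assms(1) by (simp add: b_le_iff Pop_down(1))
qed

text \<open>Stated for a meet rather than for \<open>Row\<close>, since it is used twice: with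
  \<open>Row L x = t m\<close>, and in \<open>A * B\<close>, where an element of \<open>B\<close>
  meets \<open>x\<close> in the way some \<open>t m\<close> does.\<close>

lemma meet_t_eq_Pop_down:
  assumes x: "x \<in> carrier L" and m: "m \<le> n" and eq: "x \<sqinter> t m = Pop_down L x"
  shows "x = b (h x)"
proof (rule ccontr)
  assume nb: "x \<noteq> b (h x)"
  obtain c where c: "covered_by L c x" "h c = h x" using level_lower_cover[OF x nb] .
  note cD = covered_byD[OF c(1)]
  note p = Pop_down[OF x]
  have tm: "t m \<in> carrier L" using m t_closed by simp
  have "\<not> x \<sqsubseteq> Pop_down L x"
    using p(3)[OF c(1)] p(1) cD x le_antisym le_trans by metis
  then have "\<not> x \<sqsubseteq> t m" using x tm eq meet_glb[OF x tm x] by simp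
  then have hx: "m < h x" using x m by (simp add: le_t_iff)
  have hp: "h (Pop_down L x) = m" using h_meet[OF x tm] eq hx m by (simp add: h_t)
  \<comment> \<open>If all lower covers stayed on the level of \<open>x\<close>, so would
    \<open>Pop_down L x\<close>, whose level is \<open>m\<close>. As \<open>v\<close> is only one
    level down, it lies below \<open>t m\<close>, hence below \<open>Pop_down L x\<close> and below
    \<open>c\<close>, which two distinct covers of \<open>x\<close> cannot do.\<close>
  obtain v where v: "covered_by L v x" "h v < h x"
    using level_Pop_down_ge[OF x, of "h x"] hp hx by force
  note vD = covered_byD[OF v(1)]
  have "h x - 1 \<le> h (Pop_down L x)"
    using x covered_byD(6) by (intro level_Pop_down_ge) fastforce+
  then have "v \<sqsubseteq> t m" using vD hp v m by (simp add: le_t_iff)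
  then have "v \<sqsubseteq> Pop_down L x" using vD x tm eq meet_glb[OF x tm vD(1)] by simp
  then have "v \<sqsubseteq> c" using p(1) p(3)[OF c(1)] vD(1) cD(1) le_trans by blast
  then have "c = v \<or> c = x" using vD(7) cD by blast
  then show False using cD(4) c v by auto
qed

lemma Row_eq_t:
  assumes "x \<in> carrier L" "m \<le> n" "Row L x = t m"
  shows "x = b (h x)"
  using meet_t_eq_Pop_down[OF assms(1,2)] Row(2)[OF assms(1)] assms(3) by simp

text \<open>The mixed case of meet-semidistributivity in \<open>A * B\<close>: an element of
  \<open>B\<close> on level \<open>k\<close> acts on \<open>A\<close> as \<open>t k\<close>, and its
  join with \<open>a\<close> acts as the top of the larger level. If \<open>a\<close> is above level
  \<open>k\<close>, equality of levels pushes \<open>c\<close> down to level at most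
  \<open>k\<close>, where both tops lie above it. \<open>join_b_min\<close> is the dual.\<close>

lemma meet_t_max:
  assumes C: "a \<in> carrier L" "c \<in> carrier L" and k: "k \<le> n" and eq: "a \<sqinter> c = t k \<sqinter> c"
  shows "t (max (h a) k) \<sqinter> c = t k \<sqinter> c"
proof (cases "h a \<le> k")
  case False
  have "min (h a) (h c) = min k (h c)"
    using arg_cong[OF eq, of h] C k by (simp add: h_meet t_closed h_t)
  then have hc: "h c \<le> k" using False by (simp add: min_def split: if_splits)
  have "t i \<sqinter> c = c" if "k \<le> i" "i \<le> n" for i
    using that C hc by (intro meet_eqI) (simp_all add: t_closed le_t_iff)
  then show ?thesis using C k False by (simp add: h_le_n)
qed simp

lemma join_b_min:
  assumes C: "a \<in> carrier L" "c \<in> carrier L" and k: "k \<le> n" and eq: "a \<squnion> c = b k \<squnion> c"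
  shows "b (min (h a) k) \<squnion> c = b k \<squnion> c"
proof (cases "k \<le> h a")
  case False
  have "max (h a) (h c) = max k (h c)"
    using arg_cong[OF eq, of h] C k by (simp add: h_join b_closed h_b)
  then have hc: "k \<le> h c" using False by (simp add: max_def split: if_splits)
  have "b i \<squnion> c = c" if "i \<le> k" for i
    using that C hc k by (intro join_eqI) (simp_all add: b_closed b_le_iff)
  then show ?thesis using C k False by simp
qed simp

section \<open>Injectivity of rowmotion\<close>

lemma level_upper_cover:
  assumes "y \<in> carrier L" "y \<noteq> t (h y)"
  obtains u where "covered_by L y u" "h u = h y"
proof -
  have "t (h y) \<in> carrier L" "y \<sqsubset> t (h y)"
    using assms by (auto simp: lless_eq le_t_iff t_closed h_le_n)
  then obtain u where u: "covered_by L y u" "u \<sqsubseteq> t (h y)"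
    using ex_cover_above assms by blast
  then have "h u = h y"
    using covered_byD[OF u(1)] assms by (simp add: le_t_iff h_le_n)
  then show ?thesis using that u by blast
qed

text \<open>Here \<open>Row L x\<close> is just \<open>Pop_down L x\<close>: it has the level of
  \<open>v\<close>, hence is comparable with \<open>v\<close>, and it cannot be above
  \<open>v\<close>, as this would put \<open>v\<close> below the other lower cover \<open>c\<close>.
  Of its upper covers, \<open>u\<close> is found below \<open>v\<close> and \<open>w\<close> below
  \<open>c\<close>.\<close>

lemma Row_two_lower_covers:
  assumes x: "x \<in> carrier L" "x \<noteq> b (h x)" and v: "covered_by L v x" "h v \<noteq> h x"
  shows "\<exists>u w. covered_by L (Row L x) u \<and> h u = h (Row L x) \<and>
    covered_by L (Row L x) w \<and> h w \<noteq> h (Row L x) \<and> x = u \<squnion> w"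
proof -
  obtain c where c: "covered_by L c x" "h c = h x" using level_lower_cover[OF x] .
  note cD = covered_byD[OF c(1)] and vD = covered_byD[OF v(1)]
  note p = Pop_down[OF x(1)] and y = Row[OF x(1)]
  define y where "y = Row L x"
  have yC: "y \<in> carrier L" and xy: "x \<sqinter> y = Pop_down L x"
    using y by (simp_all add: y_def)
  have hv: "h x = Suc (h v)" using vD(5,6) v by simp
  have only: "d = c \<or> d = v" if "covered_by L d x" for d
  proof -
    have "h d = h c \<or> h d = h v" using covered_byD(5,6)[OF that] hv c(2) by linarith
    then show ?thesis
      using lower_covers_same_level[OF that c(1)] lower_covers_same_level[OF that v(1)] by blast
  qed
  have nvc: "\<not> v \<sqsubseteq> c" using vD(7)[OF cD(1) _ cD(3)] cD(4) c v by auto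
  have "h v \<le> h (Pop_down L x)"
    using x(1) hv only c by (intro level_Pop_down_ge) (auto simp: hv dest: only)
  moreover have "h (Pop_down L x) \<le> h v" using h_mono p(1) p(3)[OF v(1)] vD(1) by blast
  ultimately have hp: "h (Pop_down L x) = h v" by simp
  then have hy: "h y = h v" using h_meet[OF x(1) yC] xy hv by (simp add: min_def split: if_splits)
  have yp: "y = Pop_down L x"
  proof -
    have "\<not> v \<sqsubseteq> y"
    proof
      assume "v \<sqsubseteq> y"
      then have "v \<sqsubseteq> Pop_down L x" using meet_glb[OF x(1) yC vD(1)] vD(3) xy by simp
      then show False using nvc p(1) p(3)[OF c(1)] vD(1) cD(1) le_trans by blast
    qed
    then have "y \<sqsubseteq> v" using level_chain[OF yC vD(1) hy] by blast
    then have "y \<sqsubseteq> x" using le_trans yC vD x by blast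
    then have "y \<sqsubseteq> Pop_down L x" using meet_glb[OF x(1) yC yC] xy yC by simp
    moreover have "Pop_down L x \<sqsubseteq> y" using meet_right[OF x(1) yC] xy by simp
    ultimately show ?thesis using le_antisym yC p(1) by blast
  qed
  have yv: "y \<sqsubseteq> v" and yc: "y \<sqsubseteq> c" using yp p(3) v c by auto
  \<comment> \<open>Only the \<open>b i\<close> are sent to a top element, so \<open>y\<close> still
    has an upper cover on its own level.\<close>
  have "y \<noteq> t (h y)" using Row_eq_t[OF x(1) h_le_n[OF yC]] x(2) y_def by metis
  then obtain u where u: "covered_by L y u" "h u = h y" using level_upper_cover[OF yC] by blast
  note uD = covered_byD[OF u(1)]
  have "u \<sqsubseteq> v"
    using level_chain[OF uD(2) vD(1)] u(2) hy uD(7)[OF vD(1) yv] nvc yc vD(1) by auto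
  moreover have "\<not> u \<sqsubseteq> c"
  proof
    assume "u \<sqsubseteq> c"
    with \<open>u \<sqsubseteq> v\<close> have "u \<sqsubseteq> d" if "covered_by L d x" for d using only[OF that] by auto
    moreover have "u \<sqsubseteq> x" using le_trans[OF \<open>u \<sqsubseteq> v\<close> vD(3)] uD(2) vD x by simp
    ultimately have "u \<sqsubseteq> y" using p(4)[OF uD(2)] yp by simp
    then show False using uD le_antisym by blast
  qed
  ultimately have uc: "\<not> u \<sqsubseteq> c" "u \<sqsubseteq> x"
    using le_trans[OF _ vD(3)] uD(2) vD x by simp_all
  have "y \<sqsubset> c" using yc hy hv c by (auto simp: lless_eq)
  then obtain w where w: "covered_by L y w" "w \<sqsubseteq> c" using ex_cover_above[OF yC cD(1)] by blast
  note wD = covered_byD[OF w(1)]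
  have hw: "h w \<noteq> h y" using upper_covers_same_level[OF u(1) w(1)] u(2) uc w(2) by auto
  have "w \<sqsubseteq> x" using le_trans[OF w(2) cD(3)] wD cD x by simp
  then have le: "u \<squnion> w \<sqsubseteq> x" using uc uD wD x by (simp add: join_le)
  have jC: "u \<squnion> w \<in> carrier L" using uD wD by simp
  \<comment> \<open>On the level of \<open>c\<close> but not below \<open>c\<close>, the join lies
    strictly above \<open>c\<close>; being at most \<open>x\<close>, which covers \<open>c\<close>,
    it equals \<open>x\<close>.\<close>
  have "\<not> u \<squnion> w \<sqsubseteq> c" using uc(1) join_lub[OF uD(2) wD(2) cD(1)] by simp
  moreover have "h (u \<squnion> w) = h c"
    using h_join[OF uD(2) wD(2)] u(2) hw wD(5,6) hy hv c by simp
  ultimately have "u \<squnion> w = x"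
    using level_chain[OF jC cD(1)] cD(7)[OF jC _ le] cD(1) by auto
  then show ?thesis using u w hw unfolding y_def by blast
qed

text \<open>Now \<open>x\<close> is join-irreducible and \<open>Row L x\<close> is its image under
  the classical map \<kappa>: the greatest element above the lower cover of \<open>x\<close> but not
  above \<open>x\<close>. All upper covers of \<open>Row L x\<close> are above \<open>x\<close>,
  while two distinct ones would meet in \<open>Row L x\<close>; so there is only one.\<close>

lemma Row_one_lower_cover:
  assumes x: "x \<in> carrier L" "x \<noteq> b (h x)" and one: "\<And>v. covered_by L v x \<Longrightarrow> h v = h x"
  shows "(\<forall>w. covered_by L (Row L x) w \<longrightarrow> h w = h (Row L x)) \<and>
    covered_by L (Row L x) (x \<squnion> Row L x) \<and>
    (\<forall>z\<in>carrier L. z \<sqsubset> x \<longrightarrow> z \<sqsubseteq> Row L x)"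
proof -
  obtain c where c: "covered_by L c x" "h c = h x" using level_lower_cover[OF x] .
  note cD = covered_byD[OF c(1)]
  note p = Pop_down[OF x(1)]
  define y where "y = Row L x"
  have yC: "y \<in> carrier L" and xy: "x \<sqinter> y = Pop_down L x"
    and max: "\<And>z. \<lbrakk>z \<in> carrier L; x \<sqinter> z = Pop_down L x\<rbrakk> \<Longrightarrow> z \<sqsubseteq> y"
    using Row[OF x(1)] by (simp_all add: y_def)
  have only: "d = c" if "covered_by L d x" for d
    using lower_covers_same_level[OF that c(1)] one[OF that] c(2) by simp
  have "c \<sqsubseteq> Pop_down L x" using cD only by (intro p(4)) auto
  then have pc: "Pop_down L x = c" using p(1) p(3)[OF c(1)] cD(1) le_antisym by blast
  have cy: "c \<sqsubseteq> y" using meet_right[OF x(1) yC] xy pc by simp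
  have nxy: "\<not> x \<sqsubseteq> y"
    using meet_glb[OF x(1) yC x(1)] xy pc cD le_antisym x by auto
  \<comment> \<open>The meet of \<open>x\<close> and \<open>w\<close> lies between \<open>c\<close>
    and \<open>x\<close>. It is not \<open>c\<close>, since then \<open>w\<close> would solve the
    equation whose greatest solution is \<open>y\<close>.\<close>
  have above: "x \<sqsubseteq> w" if w: "covered_by L y w" for w
  proof -
    note wD = covered_byD[OF w]
    have mC: "x \<sqinter> w \<in> carrier L" using x wD by simp
    have "c \<sqsubseteq> w" using le_trans[OF cy wD(3)] cD yC wD by simp
    then have "c \<sqsubseteq> x \<sqinter> w" using meet_glb[OF x(1) wD(2) cD(1)] cD by simp
    then have "x \<sqinter> w = c \<or> x \<sqinter> w = x" using cD(7)[OF mC] meet_left[OF x(1) wD(2)] by blast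
    moreover have "x \<sqinter> w \<noteq> c"
      using max[OF wD(2)] pc wD le_antisym by auto
    ultimately show ?thesis using meet_right[OF x(1) wD(2)] by simp
  qed
  have "y \<noteq> t (h y)" using Row_eq_t[OF x(1) h_le_n[OF yC]] x(2) y_def by metis
  then obtain u where u: "covered_by L y u" "h u = h y" using level_upper_cover[OF yC] by blast
  note uD = covered_byD[OF u(1)]
  have "h w = h y" if w: "covered_by L y w" for w
  proof (rule ccontr)
    assume ne: "h w \<noteq> h y"
    note wD = covered_byD[OF w]
    have mC: "u \<sqinter> w \<in> carrier L" using uD wD by simp
    have "y \<sqsubseteq> u \<sqinter> w" using meet_glb[OF uD(2) wD(2) yC] uD wD by simp
    then have "u \<sqinter> w = y \<or> u \<sqinter> w = u" using uD(7)[OF mC] meet_left[OF uD(2) wD(2)] by blast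
    moreover have "x \<sqsubseteq> u \<sqinter> w" using meet_glb[OF uD(2) wD(2) x(1)] above[OF u(1)] above[OF w] by simp
    ultimately have "u \<sqsubseteq> w" using nxy meet_right[OF uD(2) wD(2)] by auto
    then have "u = w" using wD(7)[OF uD(2) uD(3)] uD(4) by blast
    then show False using ne u by simp
  qed
  moreover have "x \<squnion> y = u"
  proof -
    have jC: "x \<squnion> y \<in> carrier L" using x yC by simp
    have "x \<squnion> y \<sqsubseteq> u" using join_lub[OF x(1) yC uD(2)] above[OF u(1)] uD by simp
    then have "x \<squnion> y = y \<or> x \<squnion> y = u"
      using uD(7)[OF jC] join_right[OF x(1) yC] by blast
    then show ?thesis using join_left[OF x(1) yC] nxy by auto
  qed
  moreover have "z \<sqsubseteq> y" if z: "z \<in> carrier L" "z \<sqsubset> x" for z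
  proof -
    obtain d where d: "covered_by L d x" "z \<sqsubseteq> d" using ex_cover_below[OF z(1) x(1) z(2)] .
    then have "z \<sqsubseteq> c" using only by blast
    then show ?thesis using le_trans[OF _ cy] z(1) cD yC by blast
  qed
  ultimately show ?thesis using u(1) unfolding y_def by auto
qed

text \<open>Join-semidistributivity enters here. \<open>x\<close> and \<open>x'\<close> have the
  same join with their common image, so their meet has it too; but if that meet is strictly below
  \<open>x\<close>, it lies below the image and adds nothing to it.\<close>

lemma one_lower_cover_le:
  assumes x: "x \<in> carrier L" "x \<noteq> b (h x)" "\<And>v. covered_by L v x \<Longrightarrow> h v = h x"
    and x': "x' \<in> carrier L" "x' \<noteq> b (h x')" "\<And>v. covered_by L v x' \<Longrightarrow> h v = h x'"
    and eq: "Row L x = Row L x'"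
  shows "x \<sqsubseteq> x'"
proof (rule ccontr)
  assume nle: "\<not> x \<sqsubseteq> x'"
  define y where "y = Row L x"
  have yC: "y \<in> carrier L" using Row x by (simp add: y_def)
  note r = Row_one_lower_cover[OF x, folded y_def]
  note r' = Row_one_lower_cover[OF x', folded eq, folded y_def]
  have eqj: "x \<squnion> y = x' \<squnion> y"
    using r r' upper_covers_same_level by metis
  have mC: "x \<sqinter> x' \<in> carrier L" using x x' by simp
  have "x \<sqinter> x' \<sqsubset> x"
    using meet_left[OF x(1) x'(1)] meet_right[OF x(1) x'(1)] nle by (auto simp: lless_eq)
  then have "x \<sqinter> x' \<sqsubseteq> y" using r mC by blast
  then have "(x \<sqinter> x') \<squnion> y = y" using mC yC by (intro join_eqI) auto
  then have "x \<squnion> y = y" using join_semidistributive[OF x(1) x'(1) yC eqj] by simp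
  then show False using r by (simp add: covered_by_def strict_irrefl)
qed

text \<open>
  An element \<open>x \<noteq> b\<^sub>i\<close> is recovered from \<open>y = Row x\<close>: as the join of the two upper covers of \<open>y\<close>
  if these lie on different levels, and otherwise as the least \<open>z\<close> whose join with \<open>y\<close> is the
  only upper cover of \<open>y\<close>.
\<close>
lemma Row_inj: "inj_on (Row L) (carrier L)"
proof (rule inj_onI)
  fix x x' assume x: "x \<in> carrier L" and x': "x' \<in> carrier L" and eq: "Row L x = Row L x'"
  show "x = x'"
  proof (cases "x = b (h x) \<or> x' = b (h x')")
    case True
    have Rb: "Row L z = t (prev_level n (h z))" if "z \<in> carrier L" "z = b (h z)" for z
      using Row_b[OF h_le_n[OF that(1)]] that(2) by simp
    have le: "prev_level n (h z) \<le> n" if "z \<in> carrier L" for z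
      using that by (simp add: prev_level_le h_le_n)
    have xb: "x = b (h x)" "x' = b (h x')"
    proof -
      show "x = b (h x)"
      proof (cases "x' = b (h x')")
        case b': True
        show ?thesis by (rule Row_eq_t[OF x le[OF x']]) (simp only: eq Rb[OF x' b'])
      qed (use True in blast)
      show "x' = b (h x')"
      proof (cases "x = b (h x)")
        case b: True
        show ?thesis by (rule Row_eq_t[OF x' le[OF x]]) (simp only: eq[symmetric] Rb[OF x b])
      qed (use True in blast)
    qed
    have "t (prev_level n (h x)) = t (prev_level n (h x'))"
      unfolding Rb[OF x xb(1), symmetric] Rb[OF x' xb(2), symmetric] by (fact eq)
    then have "h (t (prev_level n (h x))) = h (t (prev_level n (h x')))" by (rule arg_cong)
    then have "prev_level n (h x) = prev_level n (h x')"
      unfolding h_t[OF le[OF x]] h_t[OF le[OF x']] .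
    then have "h x = h x'" by (rule prev_level_inj[OF h_le_n[OF x] h_le_n[OF x']])
    then show ?thesis by (subst xb(1), subst xb(2)) simp
  next
    case False
    then have nb: "x \<noteq> b (h x)" "x' \<noteq> b (h x')" by auto
    consider "\<And>v. covered_by L v x \<Longrightarrow> h v = h x" "\<And>v. covered_by L v x' \<Longrightarrow> h v = h x'"
      | v where "\<And>v. covered_by L v x \<Longrightarrow> h v = h x" "covered_by L v x'" "h v \<noteq> h x'"
      | v where "covered_by L v x" "h v \<noteq> h x" "\<And>v. covered_by L v x' \<Longrightarrow> h v = h x'"
      | v v' where "covered_by L v x" "h v \<noteq> h x" "covered_by L v' x'" "h v' \<noteq> h x'"
      by metis
    then show ?thesis
    proof cases
      case 1
      then have "x \<sqsubseteq> x'" "x' \<sqsubseteq> x"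
        using one_lower_cover_le[OF x nb(1) _ x' nb(2)] one_lower_cover_le[OF x' nb(2) _ x nb(1)] eq
        by auto
      then show ?thesis using le_antisym x x' by blast
    next
      \<comment> \<open>The common image would have an upper cover on another level according to
        \<open>x'\<close>, and none according to \<open>x\<close>.\<close>
      case 2
      then show ?thesis
        using Row_one_lower_cover[OF x nb(1)] Row_two_lower_covers[OF x' nb(2)] eq by metis
    next
      case 3
      then show ?thesis
        using Row_one_lower_cover[OF x' nb(2)] Row_two_lower_covers[OF x nb(1)] eq by metis
    next
      case 4
      obtain u w where 1: "covered_by L (Row L x) u" "h u = h (Row L x)"
          "covered_by L (Row L x) w" "h w \<noteq> h (Row L x)" "x = u \<squnion> w"
        using Row_two_lower_covers[OF x nb(1) 4(1,2)] by blast
      obtain u' w' where 2: "covered_by L (Row L x) u'" "h u' = h (Row L x)"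
          "covered_by L (Row L x) w'" "h w' \<noteq> h (Row L x)" "x' = u' \<squnion> w'"
        using Row_two_lower_covers[OF x' nb(2) 4(3,4)] unfolding eq by blast
      have "u = u'" using upper_covers_same_level[OF 1(1) 2(1)] 1(2) 2(2) by simp
      moreover have "h w = h w'"
        using covered_byD(5,6)[OF 1(3)] covered_byD(5,6)[OF 2(3)] 1(4) 2(4) by simp
      then have "w = w'" by (rule upper_covers_same_level[OF 1(3) 2(3)])
      ultimately show ?thesis using 1(5) 2(5) by simp
    qed
  qed
qed

end

section \<open>Lattices with the switching property\<close>

definition bot_at :: "('a, 'c) gorder_scheme \<Rightarrow> ('a \<Rightarrow> nat \<times> nat) \<Rightarrow> nat \<Rightarrow> 'a" where
  "bot_at L pos i = (THE x. x \<in> carrier L \<and> pos x = (0, i))"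

definition top_at :: "('a, 'c) gorder_scheme \<Rightarrow> ('a \<Rightarrow> nat \<times> nat) \<Rightarrow> nat \<Rightarrow> 'a" where
  "top_at L pos i = (THE x. rightmost L pos i x)"

locale switching_lattice = semidistributive_lattice L for L (structure) +
  fixes n :: nat and pos :: "'a \<Rightarrow> nat \<times> nat"
  assumes switching: "n_switching n L pos"
begin

abbreviation level :: "'a \<Rightarrow> nat" where "level x \<equiv> snd (pos x)"

lemma pos_inj: "inj_on pos (carrier L)"
  using switching unfolding n_switching_def by blast

lemma level_le_n: "x \<in> carrier L \<Longrightarrow> level x \<le> n"
  using switching unfolding n_switching_def by blast

lemma cover_levels:
  assumes "covered_by L x y"
  shows "level y = level x \<or> level y = Suc (level x)"
proof -
  have "\<forall>x y c d c' d'. covered_by L x y \<and> pos x = (c, d) \<and> pos y = (c', d') \<longrightarrow>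
      (int c' - int c, int d' - int d) \<in> {(0, 1)} \<union> {(m, 0) | m. True}"
    using switching unfolding n_switching_def by blast
  then have "(int (fst (pos y)) - int (fst (pos x)), int (level y) - int (level x))
      \<in> {(0, 1)} \<union> {(m, 0) | m. True}"
    using assms by (metis prod.collapse)
  then show ?thesis by auto
qed

lemma level_le_iff:
  assumes "x \<in> carrier L" "y \<in> carrier L" "level x = level y"
  shows "x \<sqsubseteq> y \<longleftrightarrow> fst (pos x) \<le> fst (pos y)"
proof -
  have "\<forall>x\<in>carrier L. \<forall>y\<in>carrier L. \<forall>c c' d.
      pos x = (c, d) \<and> pos y = (c', d) \<longrightarrow> (x \<sqsubseteq> y \<longleftrightarrow> c \<le> c')"
    using switching unfolding n_switching_def by blast
  then show ?thesis using assms by (metis prod.collapse)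
qed

lemma bot_at_iff:
  assumes "i \<le> n"
  shows "x \<in> carrier L \<and> pos x = (0, i) \<longleftrightarrow> x = bot_at L pos i"
proof -
  have "(0, i) \<in> pos ` carrier L"
    using switching assms unfolding n_switching_def by simp
  then have "\<exists>!x. x \<in> carrier L \<and> pos x = (0, i)"
    using pos_inj unfolding inj_on_def by (metis imageE)
  from theI'[OF this] this show ?thesis unfolding bot_at_def by blast
qed

lemma bot_at:
  assumes "i \<le> n"
  shows "bot_at L pos i \<in> carrier L" "pos (bot_at L pos i) = (0, i)"
  using bot_at_iff[OF assms] by blast+

lemma top_at_iff:
  assumes "i \<le> n"
  shows "rightmost L pos i x \<longleftrightarrow> x = top_at L pos i"
proof -
  let ?S = "{x \<in> carrier L. level x = i}"
  have "finite ?S" "?S \<noteq> {}"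
    using finite_carrier bot_at[OF assms] by auto
  then have "Max ((\<lambda>x. fst (pos x)) ` ?S) \<in> (\<lambda>x. fst (pos x)) ` ?S" by simp
  then obtain m where m: "m \<in> ?S" "fst (pos m) = Max ((\<lambda>x. fst (pos x)) ` ?S)" by auto
  have r: "rightmost L pos i m"
    using m \<open>finite ?S\<close> by (auto simp: rightmost_def)
  have "x = m" if x: "rightmost L pos i x" for x
  proof (rule inj_onD[OF pos_inj])
    show "pos x = pos m"
      using x r by (intro prod_eqI) (auto simp: rightmost_def intro!: order.antisym)
  qed (use x r in \<open>auto simp: rightmost_def\<close>)
  then have ex1: "\<exists>!x. rightmost L pos i x" using r by blast
  from theI'[OF this] this show ?thesis unfolding top_at_def by blast
qed

lemma top_at:
  assumes "i \<le> n"
  shows "top_at L pos i \<in> carrier L" "level (top_at L pos i) = i"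
    "\<And>x. x \<in> carrier L \<Longrightarrow> level x = i \<Longrightarrow> x \<sqsubseteq> top_at L pos i"
proof -
  have r: "rightmost L pos i (top_at L pos i)" using top_at_iff[OF assms] by blast
  then show C: "top_at L pos i \<in> carrier L" "level (top_at L pos i) = i"
    by (auto simp: rightmost_def)
  show "x \<sqsubseteq> top_at L pos i" if "x \<in> carrier L" "level x = i" for x
    using that r C level_le_iff[of x "top_at L pos i"] by (simp add: rightmost_def)
qed

lemma level_mono:
  assumes "x \<in> carrier L" "y \<in> carrier L" "x \<sqsubseteq> y"
  shows "level x \<le> level y"
  using le_imp_covers[OF assms]
  by (induction rule: rtranclp_induct) (auto dest!: cover_levels)

lemma bot_at_cover: "i < n \<Longrightarrow> covered_by L (bot_at L pos i) (bot_at L pos (Suc i))"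
proof -
  assume "i < n"
  moreover have "\<forall>i\<in>{1..n}. \<forall>x\<in>carrier L. \<forall>y\<in>carrier L.
         pos x = (0, i - 1) \<and> pos y = (0, i) \<longrightarrow> covered_by L x y"
    using switching unfolding n_switching_def by blast
  then have "\<forall>x\<in>carrier L. \<forall>y\<in>carrier L.
         pos x = (0, Suc i - 1) \<and> pos y = (0, Suc i) \<longrightarrow> covered_by L x y"
    using \<open>i < n\<close> by (metis One_nat_def Suc_leI atLeastAtMost_iff le_add1 plus_1_eq_Suc)
  ultimately show ?thesis using bot_at[of i] bot_at[of "Suc i"] by simp
qed

lemma bot_at_mono:
  assumes "i \<le> j" "j \<le> n"
  shows "bot_at L pos i \<sqsubseteq> bot_at L pos j"
  using assms
proof (induction j rule: dec_induct)
  case base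
  then show ?case by (simp add: bot_at)
next
  case (step j)
  have "bot_at L pos j \<sqsubseteq> bot_at L pos (Suc j)"
    using bot_at_cover[of j] step by (simp add: covered_by_def lless_eq)
  then show ?case
    using step le_trans[of "bot_at L pos i" "bot_at L pos j"] by (simp add: bot_at)
qed

text \<open>The greatest element has level \<open>n\<close>, so for \<open>i < n\<close> the top of
  level \<open>i\<close> has an upper cover. That cover cannot lie on level \<open>i\<close>, hence
  it lies on level \<open>Suc i\<close> and below the top there.\<close>

lemma top_at_Suc:
  assumes "i < n"
  shows "top_at L pos i \<sqsubseteq> top_at L pos (Suc i)"
proof -
  have C: "top_at L pos i \<in> carrier L" "level (top_at L pos i) = i"
    using assms by (simp_all add: top_at)
  obtain T where T: "T \<in> carrier L" "\<And>z. z \<in> carrier L \<Longrightarrow> z \<sqsubseteq> T"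
    by (rule ex_greatest[OF C(1)]) blast
  have "n \<le> level T"
    using level_mono[OF bot_at(1)[OF order_refl] T(1) T(2)] bot_at[of n] by simp
  then have "top_at L pos i \<sqsubset> T" using C T assms by (auto simp: lless_eq)
  then obtain u where u: "covered_by L (top_at L pos i) u"
    using ex_cover_above[OF C(1) T(1)] by blast
  then have uD: "u \<in> carrier L" "top_at L pos i \<sqsubseteq> u" "top_at L pos i \<noteq> u"
    by (auto simp: covered_by_def lless_eq)
  have "level u \<noteq> i"
    using top_at(3)[of i u] assms uD C le_antisym by auto
  then have "u \<sqsubseteq> top_at L pos (Suc i)"
    using cover_levels[OF u] C uD assms by (simp add: top_at)
  then show ?thesis using le_trans[OF uD(2)] uD C assms by (simp add: top_at)
qed

lemma top_at_mono:
  assumes "i \<le> j" "j \<le> n"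
  shows "top_at L pos i \<sqsubseteq> top_at L pos j"
  using assms
proof (induction j rule: dec_induct)
  case base
  then show ?case by (simp add: top_at)
next
  case (step j)
  then show ?case
    using top_at_Suc[of j] le_trans[of "top_at L pos i" "top_at L pos j"] by (simp add: top_at)
qed

text \<open>Each adjunction compares inside the level of \<open>x\<close> first and then moves along
  the chain of tops or of bottoms; the converse is monotonicity of the level.\<close>

sublocale levelled_lattice L n level "bot_at L pos" "top_at L pos"
proof
  fix i x assume x: "x \<in> carrier L" and i: "i \<le> n"
  show "x \<sqsubseteq> top_at L pos i \<longleftrightarrow> level x \<le> i"
  proof
    assume "x \<sqsubseteq> top_at L pos i"
    then show "level x \<le> i" using level_mono[OF x] top_at(1,2)[OF i] by force
  next
    assume le: "level x \<le> i"
    then show "x \<sqsubseteq> top_at L pos i"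
      using le_trans[OF top_at(3)[OF level_le_n[OF x] x HOL.refl] top_at_mono[OF le i]] x i top_at(1) level_le_n[OF x] by simp
  qed
  show "bot_at L pos i \<sqsubseteq> x \<longleftrightarrow> i \<le> level x"
  proof
    assume "bot_at L pos i \<sqsubseteq> x"
    then show "i \<le> level x" using level_mono[OF bot_at(1)[OF i] x] bot_at(2)[OF i] by simp
  next
    assume le: "i \<le> level x"
    have n: "level x \<le> n" using x by (rule level_le_n)
    have "bot_at L pos (level x) \<sqsubseteq> x"
      using level_le_iff[OF bot_at(1)[OF n] x] bot_at(2)[OF n] by simp
    then show "bot_at L pos i \<sqsubseteq> x"
      using le_trans[OF bot_at_mono[OF le n]] x i n bot_at(1) by simp
  qed
next
  fix x y assume "x \<in> carrier L" "y \<in> carrier L" "level x = level y"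
  then show "x \<sqsubseteq> y \<or> y \<sqsubseteq> x" using level_le_iff[of x y] level_le_iff[of y x] by auto
next
  fix x y assume "covered_by L x y"
  then show "level y \<le> Suc (level x)" using cover_levels by fastforce
qed (simp_all add: bot_at top_at level_le_n bot_at_cover)

end

lemma switching_latticeI:
  assumes "finite_semidistributive_lattice L" "n_switching n L pos"
  shows "switching_lattice L n pos"
proof -
  interpret lattice L using assms(1) by (simp add: finite_semidistributive_lattice_def)
  show ?thesis using assms by unfold_locales
qed

section \<open>The lattice \<open>A * B\<close>\<close>

locale switching_pair =
  A: switching_lattice A n posA + B: switching_lattice B n posB
  for A :: "'a gorder" and B :: "'b gorder" and n posA posB
begin

abbreviation "S \<equiv> star_poset n A posA B posB"
abbreviation "bA \<equiv> bot_at A posA"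
abbreviation "tA \<equiv> top_at A posA"
abbreviation "bB \<equiv> bot_at B posB"
abbreviation "tB \<equiv> top_at B posB"

fun star_le :: "'a + 'b \<Rightarrow> 'a + 'b \<Rightarrow> bool" where
  "star_le (Inl x) (Inl y) \<longleftrightarrow> x \<sqsubseteq>\<^bsub>A\<^esub> y"
| "star_le (Inr x) (Inr y) \<longleftrightarrow> x \<sqsubseteq>\<^bsub>B\<^esub> y"
| "star_le (Inl x) (Inr y) \<longleftrightarrow> A.level x \<le> B.level y"
| "star_le (Inr x) (Inl y) \<longleftrightarrow> False"

text \<open>\<open>bB (A.level x)\<close> is the least element of \<open>B\<close> above
  \<open>x\<close>, so a mixed join is taken in \<open>B\<close>. Dually, mixed meets in
  \<open>star_meet\<close> replace \<open>y\<close> by the greatest element of \<open>A\<close>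
  below it. Both argument orders share one right-hand side.\<close>

fun star_join :: "'a + 'b \<Rightarrow> 'a + 'b \<Rightarrow> 'a + 'b" where
  "star_join (Inl x) (Inl y) = Inl (x \<squnion>\<^bsub>A\<^esub> y)"
| "star_join (Inr x) (Inr y) = Inr (x \<squnion>\<^bsub>B\<^esub> y)"
| "star_join (Inl x) (Inr y) = Inr (bB (A.level x) \<squnion>\<^bsub>B\<^esub> y)"
| "star_join (Inr y) (Inl x) = Inr (bB (A.level x) \<squnion>\<^bsub>B\<^esub> y)"

fun star_meet :: "'a + 'b \<Rightarrow> 'a + 'b \<Rightarrow> 'a + 'b" where
  "star_meet (Inl x) (Inl y) = Inl (x \<sqinter>\<^bsub>A\<^esub> y)"
| "star_meet (Inr x) (Inr y) = Inr (x \<sqinter>\<^bsub>B\<^esub> y)"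
| "star_meet (Inl x) (Inr y) = Inl (tA (B.level y) \<sqinter>\<^bsub>A\<^esub> x)"
| "star_meet (Inr y) (Inl x) = Inl (tA (B.level y) \<sqinter>\<^bsub>A\<^esub> x)"

lemma carrier_simps [simp]:
  "Inl x \<in> carrier S \<longleftrightarrow> x \<in> carrier A" "Inr y \<in> carrier S \<longleftrightarrow> y \<in> carrier B"
  by (auto simp: star_poset_def)

lemma carrier_cases:
  assumes "z \<in> carrier S"
  obtains x where "z = Inl x" "x \<in> carrier A" | y where "z = Inr y" "y \<in> carrier B"
  using assms by (cases z) auto

lemma star_le_trans:
  assumes "u \<in> carrier S" "v \<in> carrier S" "w \<in> carrier S" "star_le u v" "star_le v w"
  shows "star_le u w"
  using assms
  by (elim carrier_cases; simp)
    (meson A.le_trans B.le_trans A.level_mono B.level_mono order.trans)+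

lemma star_cover_iff:
  "star_cover n A posA B posB z w \<longleftrightarrow>
     (case (z, w) of
       (Inl x, Inl y) \<Rightarrow> covered_by A x y
     | (Inr x, Inr y) \<Rightarrow> covered_by B x y
     | (Inl x, Inr y) \<Rightarrow> (\<exists>m\<le>n. x = tA m \<and> y = bB m)
     | (Inr x, Inl y) \<Rightarrow> False)"
  by (cases z; cases w) (simp_all add: star_cover.simps, metis A.top_at_iff B.bot_at_iff)

lemma star_cover_le:
  assumes "star_cover n A posA B posB z w"
  shows "z \<in> carrier S" "w \<in> carrier S" "star_le z w"
  using assms unfolding star_cover_iff
  by (auto simp: covered_by_def lless_def A.top_at B.bot_at split: sum.splits)

lemma star_covers_le:
  assumes "(star_cover n A posA B posB)\<^sup>*\<^sup>* z w" "z \<in> carrier S"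
  shows "w \<in> carrier S \<and> star_le z w"
  using assms
proof (induction rule: rtranclp_induct)
  case base
  then show ?case by (cases z) auto
next
  case (step y w)
  then show ?case using star_cover_le[OF step(2)] star_le_trans[of z y w] by blast
qed

lemma covers_Inl:
  assumes "x \<in> carrier A" "y \<in> carrier A" "x \<sqsubseteq>\<^bsub>A\<^esub> y"
  shows "(star_cover n A posA B posB)\<^sup>*\<^sup>* (Inl x) (Inl y)"
  using A.le_imp_covers[OF assms]
  by (induction rule: rtranclp_induct) (auto intro: rtranclp.rtrancl_into_rtrancl star_cover.left)

lemma covers_Inr:
  assumes "x \<in> carrier B" "y \<in> carrier B" "x \<sqsubseteq>\<^bsub>B\<^esub> y"
  shows "(star_cover n A posA B posB)\<^sup>*\<^sup>* (Inr x) (Inr y)"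
  using B.le_imp_covers[OF assms]
  by (induction rule: rtranclp_induct) (auto intro: rtranclp.rtrancl_into_rtrancl star_cover.right)

lemma le_iff:
  assumes "z \<in> carrier S" "w \<in> carrier S"
  shows "z \<sqsubseteq>\<^bsub>S\<^esub> w \<longleftrightarrow> star_le z w"
proof
  show "star_le z w" if "z \<sqsubseteq>\<^bsub>S\<^esub> w"
    using that star_covers_le assms by (simp add: star_poset_def)
  show "z \<sqsubseteq>\<^bsub>S\<^esub> w" if le: "star_le z w"
  proof (cases z; cases w)
    fix x y assume zw: "z = Inl x" "w = Inr y"
    \<comment> \<open>The path crosses on the level of \<open>y\<close>: \<open>tA m\<close> is
      above \<open>x\<close> by the level bound, and \<open>bB m\<close> is below
      \<open>y\<close>.\<close>
    define m where "m = B.level y"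
    have m: "m \<le> n" "x \<in> carrier A" "y \<in> carrier B" "A.level x \<le> m"
      using zw assms le B.level_le_n by (auto simp: m_def)
    have "(star_cover n A posA B posB)\<^sup>*\<^sup>* (Inl x) (Inl (tA m))"
      using m by (intro covers_Inl) (simp_all add: A.top_at A.le_t_iff)
    also have "star_cover n A posA B posB (Inl (tA m)) (Inr (bB m))"
      using m by (auto simp: star_cover_iff)
    also have "(star_cover n A posA B posB)\<^sup>*\<^sup>* (Inr (bB m)) (Inr y)"
      using m by (intro covers_Inr) (simp_all add: B.bot_at B.b_le_iff m_def)
    finally show ?thesis using zw by (simp add: star_poset_def)
  qed (use assms le covers_Inl covers_Inr in \<open>auto simp: star_poset_def\<close>)
qed

sublocale S: finite_poset S
proof unfold_locales
  fix x y assume "x \<sqsubseteq>\<^bsub>S\<^esub> y" "y \<sqsubseteq>\<^bsub>S\<^esub> x" "x \<in> carrier S" "y \<in> carrier S"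
  then have "x = y"
    unfolding le_iff by (elim carrier_cases) (auto simp: le_iff intro: A.le_antisym B.le_antisym)
  then show "x .=\<^bsub>S\<^esub> y" by (simp add: star_poset_def)
next
  fix x y z assume "x \<sqsubseteq>\<^bsub>S\<^esub> y" "y \<sqsubseteq>\<^bsub>S\<^esub> z" "x \<in> carrier S" "y \<in> carrier S" "z \<in> carrier S"
  then show "x \<sqsubseteq>\<^bsub>S\<^esub> z" using star_le_trans[of x y z] by (simp add: le_iff)
next
  show "finite (carrier S)"
    using A.finite_carrier B.finite_carrier by (simp add: star_poset_def)
qed (auto simp: star_poset_def)

section \<open>Joins and meets of \<open>A * B\<close>\<close>

lemma star_join_closed: "z \<in> carrier S \<Longrightarrow> w \<in> carrier S \<Longrightarrow> star_join z w \<in> carrier S"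
  by (elim carrier_cases) (simp_all add: A.level_le_n B.bot_at)

lemma star_meet_closed: "z \<in> carrier S \<Longrightarrow> w \<in> carrier S \<Longrightarrow> star_meet z w \<in> carrier S"
  by (elim carrier_cases) (simp_all add: B.level_le_n A.top_at)

text \<open>Preservation of joins by the level is what settles two elements of \<open>A\<close>
  below one of \<open>B\<close>; the mixed joins come down to \<open>B.b_le_iff\<close>.\<close>

lemma star_join_lub:
  assumes "z \<in> carrier S" "w \<in> carrier S" "v \<in> carrier S"
  shows "star_le (star_join z w) v \<longleftrightarrow> star_le z v \<and> star_le w v"
  using assms by (elim carrier_cases)
    (auto simp: A.join_lub B.join_lub A.h_join B.h_join A.level_le_n B.bot_at B.b_le_iff)

lemma star_meet_glb:
  assumes "z \<in> carrier S" "w \<in> carrier S" "v \<in> carrier S"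
  shows "star_le v (star_meet z w) \<longleftrightarrow> star_le v z \<and> star_le v w"
  using assms by (elim carrier_cases)
    (auto simp: A.meet_glb B.meet_glb A.h_meet B.h_meet B.level_le_n A.top_at A.le_t_iff)

sublocale S: lattice S
proof unfold_locales
  fix x y assume C: "x \<in> carrier S" "y \<in> carrier S"
  note J = star_join_closed[OF C] and M = star_meet_closed[OF C]
  have "least S (star_join x y) (Upper S {x, y})"
  proof (rule least_UpperI)
    show "z \<sqsubseteq>\<^bsub>S\<^esub> star_join x y" if "z \<in> {x, y}" for z
      using star_join_lub[OF C J] le_iff[OF J J] le_iff[OF C(1) J] le_iff[OF C(2) J] J that
      by (auto simp: S.le_refl)
    show "star_join x y \<sqsubseteq>\<^bsub>S\<^esub> z" if "z \<in> Upper S {x, y}" for z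
      using that C J star_join_lub by (auto simp: Upper_def le_iff)
  qed (use C J in auto)
  then show "\<exists>s. is_lub S s {x, y}" ..
  have "greatest S (star_meet x y) (Lower S {x, y})"
  proof (rule greatest_LowerI)
    show "star_meet x y \<sqsubseteq>\<^bsub>S\<^esub> z" if "z \<in> {x, y}" for z
      using star_meet_glb[OF C M] le_iff[OF M M] le_iff[OF M C(1)] le_iff[OF M C(2)] M that
      by (auto simp: S.le_refl)
    show "z \<sqsubseteq>\<^bsub>S\<^esub> star_meet x y" if "z \<in> Lower S {x, y}" for z
      using that C M star_meet_glb by (auto simp: Lower_def le_iff)
  qed (use C M in auto)
  then show "\<exists>s. is_glb S s {x, y}" ..
qed

lemma meet_eq:
  assumes C: "z \<in> carrier S" "w \<in> carrier S"
  shows "z \<sqinter>\<^bsub>S\<^esub> w = star_meet z w"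
proof -
  note M = star_meet_closed[OF C]
  have "star_le (star_meet z w) (star_meet z w)" using le_iff[OF M M] M by (simp add: S.le_refl)
  then show ?thesis
    using C M star_meet_glb by (intro S.meet_eqI) (simp_all add: le_iff)
qed

lemma join_eq:
  assumes C: "z \<in> carrier S" "w \<in> carrier S"
  shows "z \<squnion>\<^bsub>S\<^esub> w = star_join z w"
proof -
  note M = star_join_closed[OF C]
  have "star_le (star_join z w) (star_join z w)" using le_iff[OF M M] M by (simp add: S.le_refl)
  then show ?thesis
    using C M star_join_lub by (intro S.join_eqI) (simp_all add: le_iff)
qed

text \<open>If \<open>z\<close>, \<open>w\<close> are in \<open>A\<close> and \<open>y\<close> in
  \<open>B\<close>, then \<open>y\<close> acts as a top of \<open>A\<close>. If \<open>z\<close>,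
  \<open>w\<close> are in \<open>B\<close> and \<open>y\<close> in \<open>A\<close>, the join acts
  as one of the two tops. If just one of \<open>z\<close>, \<open>w\<close> is in \<open>A\<close>,
  then \<open>y\<close> in \<open>A\<close> is \<open>meet_t_max\<close>, and \<open>y\<close> in
  \<open>B\<close> is impossible because the two meets lie in different factors.\<close>

lemma star_meet_semidistributive:
  assumes "z \<in> carrier S" "w \<in> carrier S" "y \<in> carrier S" "star_meet z y = star_meet w y"
  shows "star_meet (star_join z w) y = star_meet z y"
  using assms(1)
proof (cases rule: carrier_cases)
  case z: (1 a)
  from assms(2) show ?thesis
  proof (cases rule: carrier_cases)
    case w: (1 a')
    from assms(3) show ?thesis
    proof (cases rule: carrier_cases)
      case y: (1 c)
      then show ?thesis using z w y assms(4) A.meet_semidistributive[of a a' c] by simp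
    next
      case y: (2 c)
      then have "tA (B.level c) \<in> carrier A" by (simp add: A.top_at B.level_le_n)
      then show ?thesis
        using z w y assms(4) A.meet_semidistributive[of a a' "tA (B.level c)"]
        by (simp add: meet_comm)
    qed
  next
    case w: (2 d)
    from assms(3) show ?thesis
    proof (cases rule: carrier_cases)
      case y: (1 c)
      then show ?thesis
        using z w y assms(4) A.meet_t_max[of a c "B.level d"]
        by (simp add: B.h_join B.bot_at A.level_le_n B.level_le_n)
    next
      case y: (2 c)
      then show ?thesis using z w assms(4) by simp
    qed
  qed
next
  case z: (2 d)
  from assms(2) show ?thesis
  proof (cases rule: carrier_cases)
    case w: (1 a)
    from assms(3) show ?thesis
    proof (cases rule: carrier_cases)
      case y: (1 c)
      then show ?thesis
        using z w y assms(4) A.meet_t_max[of a c "B.level d"]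
        by (simp add: B.h_join B.bot_at A.level_le_n B.level_le_n)
    next
      case y: (2 c)
      then show ?thesis using z w assms(4) by simp
    qed
  next
    case w: (2 d')
    from assms(3) show ?thesis
    proof (cases rule: carrier_cases)
      case y: (1 c)
      then show ?thesis using z w y assms(4) by (simp add: B.h_join max_def)
    next
      case y: (2 c)
      then show ?thesis using z w y assms(4) B.meet_semidistributive[of d d' c] by simp
    qed
  qed
qed

lemma star_join_semidistributive:
  assumes "z \<in> carrier S" "w \<in> carrier S" "x \<in> carrier S" "star_join z x = star_join w x"
  shows "star_join (star_meet z w) x = star_join z x"
  using assms(1)
proof (cases rule: carrier_cases)
  case z: (1 a)
  from assms(2) show ?thesis
  proof (cases rule: carrier_cases)
    case w: (1 a')
    from assms(3) show ?thesis
    proof (cases rule: carrier_cases)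
      case y: (1 c)
      then show ?thesis using z w y assms(4) A.join_semidistributive[of a a' c] by simp
    next
      case y: (2 c)
      then show ?thesis using z w y assms(4) by (simp add: A.h_meet min_def)
    qed
  next
    case w: (2 d)
    from assms(3) show ?thesis
    proof (cases rule: carrier_cases)
      case y: (1 c)
      then show ?thesis using z w assms(4) by simp
    next
      case y: (2 c)
      then show ?thesis
        using z w y assms(4) B.join_b_min[of d c "A.level a"]
        by (simp add: A.h_meet A.top_at A.level_le_n B.level_le_n)
    qed
  qed
next
  case z: (2 d)
  from assms(2) show ?thesis
  proof (cases rule: carrier_cases)
    case w: (1 a)
    from assms(3) show ?thesis
    proof (cases rule: carrier_cases)
      case y: (1 c)
      then show ?thesis using z w assms(4) by simp
    next
      case y: (2 c)
      then show ?thesis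
        using z w y assms(4) B.join_b_min[of d c "A.level a"]
        by (simp add: A.h_meet A.top_at A.level_le_n B.level_le_n)
    qed
  next
    case w: (2 d')
    from assms(3) show ?thesis
    proof (cases rule: carrier_cases)
      case y: (1 c)
      then have "bB (A.level c) \<in> carrier B" by (simp add: B.bot_at A.level_le_n)
      then show ?thesis
        using z w y assms(4) B.join_semidistributive[of d d' "bB (A.level c)"]
        by (simp add: join_comm)
    next
      case y: (2 c)
      then show ?thesis using z w y assms(4) B.join_semidistributive[of d d' c] by simp
    qed
  qed
qed

lemma semidistributive_star: "finite_semidistributive_lattice S"
proof (rule S.finite_semidistributive_latticeI)
  show "lattice S" by unfold_locales
  show "(z \<squnion>\<^bsub>S\<^esub> w) \<sqinter>\<^bsub>S\<^esub> y = x"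
    if "z \<in> carrier S" "w \<in> carrier S" "x \<in> carrier S" "y \<in> carrier S"
      "z \<sqinter>\<^bsub>S\<^esub> y = x" "w \<sqinter>\<^bsub>S\<^esub> y = x" for x y z w
    using that star_meet_semidistributive[of z w y]
    by (simp add: meet_eq join_eq star_join_closed)
  show "(z \<sqinter>\<^bsub>S\<^esub> w) \<squnion>\<^bsub>S\<^esub> x = y"
    if "z \<in> carrier S" "w \<in> carrier S" "x \<in> carrier S" "y \<in> carrier S"
      "z \<squnion>\<^bsub>S\<^esub> x = y" "w \<squnion>\<^bsub>S\<^esub> x = y" for x y z w
    using that star_join_semidistributive[of z w x]
    by (simp add: meet_eq join_eq star_meet_closed)
qed

sublocale S: semidistributive_lattice S
  by unfold_locales (rule semidistributive_star)

end

section \<open>Rowmotion on \<open>A * B\<close>\<close>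

context switching_pair
begin

section \<open>Covers and down-degrees of \<open>A * B\<close>\<close>

lemma not_below_top_at: "m \<le> n \<Longrightarrow> x \<in> carrier A \<Longrightarrow> A.level x \<le> m \<Longrightarrow> \<not> tA m \<sqsubset>\<^bsub>A\<^esub> x"
  using A.le_t_iff[of x m] A.le_antisym A.top_at(1) by (auto simp: A.lless_eq)

text \<open>For a crossing from \<open>tA m\<close> to \<open>bB m\<close>: an element of
  \<open>A\<close> in between has level at most \<open>m\<close> and is above \<open>tA m\<close>,
  so it is \<open>tA m\<close>; an element of \<open>B\<close> in between is above
  \<open>bB m\<close>, so it is \<open>bB m\<close>.\<close>

lemma star_cover_covered:
  assumes "star_cover n A posA B posB z w"
  shows "covered_by S z w"
proof -
  note C = star_cover_le[OF assms]
  have "z \<noteq> w" using assms unfolding star_cover_iff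
    by (auto simp: covered_by_def A.strict_irrefl B.strict_irrefl split: sum.splits)
  then have less: "z \<sqsubset>\<^bsub>S\<^esub> w" using C by (simp add: S.lless_eq le_iff)
  have "v = z \<or> v = w" if v: "v \<in> carrier S" "star_le z v" "star_le v w" for v
    using v(1)
  proof (cases rule: carrier_cases)
    case a: (1 a)
    show ?thesis
    proof (cases z)
      case x: (Inl x)
      show ?thesis
      proof (cases w)
        case (Inl y)
        then show ?thesis using assms v a x A.covered_byD(7)[of x y a] by (simp add: star_cover_iff)
      next
        case (Inr y)
        then obtain m where "m \<le> n" "x = tA m" "y = bB m"
          using assms x by (auto simp: star_cover_iff)
        then show ?thesis
          using v a x Inr not_below_top_at[of m a] by (auto simp: A.lless_eq B.bot_at)
      qed
    qed (use v a in simp)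
  next
    case d: (2 d)
    show ?thesis
    proof (cases w)
      case y: (Inr y)
      show ?thesis
      proof (cases z)
        case (Inr x)
        then show ?thesis using assms v d y B.covered_byD(7)[of x y d] by (simp add: star_cover_iff)
      next
        case (Inl x)
        then obtain m where m: "m \<le> n" "x = tA m" "y = bB m"
          using assms y by (auto simp: star_cover_iff)
        then have "bB m \<sqsubseteq>\<^bsub>B\<^esub> d" using v d Inl by (simp add: B.b_le_iff A.top_at)
        then have "d = bB m" using m v d y B.le_antisym[of d "bB m"] by (simp add: B.bot_at)
        then show ?thesis using d y m by simp
      qed
    qed (use v d in simp)
  qed
  then show ?thesis using C less unfolding covered_by_def by (auto simp: S.lless_eq le_iff)
qed

text \<open>For the forward direction, the first step of a generating path is already a cover, so
  the path of a cover ends there.\<close>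

lemma covered_by_star: "covered_by S z w \<longleftrightarrow> star_cover n A posA B posB z w"
proof
  assume cov: "covered_by S z w"
  then have C: "z \<in> carrier S" "w \<in> carrier S" "z \<sqsubseteq>\<^bsub>S\<^esub> w" "z \<noteq> w"
    by (auto simp: covered_by_def S.lless_eq)
  then have "(star_cover n A posA B posB)\<^sup>*\<^sup>* z w" by (simp add: star_poset_def)
  then obtain v where v: "star_cover n A posA B posB z v" "(star_cover n A posA B posB)\<^sup>*\<^sup>* v w"
    using C(4) by (metis converse_rtranclpE)
  have zv: "covered_by S z v" by (rule star_cover_covered[OF v(1)])
  have "v \<sqsubseteq>\<^bsub>S\<^esub> w" using v(2) by (simp add: star_poset_def)
  then have "v = w" using cov zv unfolding covered_by_def S.lless_eq by blast
  then show "star_cover n A posA B posB z w" using v by simp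
qed (rule star_cover_covered)

lemma covered_by_simps [simp]:
  "covered_by S (Inl x) (Inl x') \<longleftrightarrow> covered_by A x x'"
  "covered_by S (Inr y) (Inr y') \<longleftrightarrow> covered_by B y y'"
  "covered_by S (Inl x) (Inr y) \<longleftrightarrow> (\<exists>m\<le>n. x = tA m \<and> y = bB m)"
  "\<not> covered_by S (Inr y) (Inl x)"
  by (simp_all add: covered_by_star star_cover_iff)

lemma lower_covers_Inl: "{c. covered_by S c (Inl x)} = Inl ` {c. covered_by A c x}"
proof (intro Set.set_eqI iffI)
  fix c assume "c \<in> {c. covered_by S c (Inl x)}"
  then show "c \<in> Inl ` {c. covered_by A c x}" by (cases c) auto
qed auto

lemma lower_covers_Inr:
  assumes "y \<in> carrier B"
  shows "{c. covered_by S c (Inr y)} = Inr ` {c. covered_by B c y} \<union>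
    (if y = bB (B.level y) then {Inl (tA (B.level y))} else {})"
proof (intro Set.set_eqI iffI)
  fix c assume "c \<in> {c. covered_by S c (Inr y)}"
  then show "c \<in> Inr ` {c. covered_by B c y} \<union>
    (if y = bB (B.level y) then {Inl (tA (B.level y))} else {})"
    by (cases c) (auto simp: B.bot_at)
next
  fix c assume "c \<in> Inr ` {c. covered_by B c y} \<union>
    (if y = bB (B.level y) then {Inl (tA (B.level y))} else {})"
  then show "c \<in> {c. covered_by S c (Inr y)}"
    using B.level_le_n[OF assms] by (auto split: if_splits)
qed

lemma ddeg_Inl: "ddeg S (Inl x) = ddeg A x"
  unfolding ddeg_def lower_covers_Inl by (simp add: card_image)

lemma ddeg_Inr:
  assumes "y \<in> carrier B"
  shows "ddeg S (Inr y) = ddeg B y + (if y = bB (B.level y) then 1 else 0)"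
proof -
  have "finite {c. covered_by B c y}"
    by (rule finite_subset[OF _ B.finite_carrier]) (auto simp: covered_by_def)
  then have "finite (Inr ` {c. covered_by B c y} :: ('a + 'b) set)" by simp
  then show ?thesis
    unfolding ddeg_def lower_covers_Inr[OF assms]
    by (auto simp: card_image card_insert_if)
qed

section \<open>\<open>Pop_down\<close> and \<open>Row\<close> on the two factors\<close>

lemma Pop_down_star:
  assumes z: "z \<in> carrier S" and p: "p \<in> carrier S" "star_le p z"
    and lb: "\<And>c. covered_by S c z \<Longrightarrow> star_le p c"
    and glb: "\<And>v. \<lbrakk>v \<in> carrier S; star_le v z; \<And>c. covered_by S c z \<Longrightarrow> star_le v c\<rbrakk> \<Longrightarrow> star_le v p"
  shows "Pop_down S z = p"
proof -
  have C: "c \<in> carrier S" if "covered_by S c z" for c using that by (simp add: covered_by_def)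
  obtain T where T: "T \<in> carrier S" "\<And>v. v \<in> carrier S \<Longrightarrow> v \<sqsubseteq>\<^bsub>S\<^esub> T"
    by (rule S.ex_greatest[OF z]) blast
  show ?thesis
  proof (rule S.Pop_down_eqI[OF z p(1) _ _ _ T])
    show "p \<sqsubseteq>\<^bsub>S\<^esub> z" using p z by (simp add: le_iff)
    show "p \<sqsubseteq>\<^bsub>S\<^esub> c" if "covered_by S c z" for c using lb[OF that] p C[OF that] by (simp add: le_iff)
    show "v \<sqsubseteq>\<^bsub>S\<^esub> p"
      if v: "v \<in> carrier S" "v \<sqsubseteq>\<^bsub>S\<^esub> z" "\<And>c. covered_by S c z \<Longrightarrow> v \<sqsubseteq>\<^bsub>S\<^esub> c" for v
    proof -
      have "star_le v p"
        using v(1,2) v(3) z C by (intro glb) (simp_all add: le_iff[symmetric])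
      then show ?thesis using v p by (simp add: le_iff)
    qed
  qed
qed

lemma Row_star:
  assumes "z \<in> carrier S" "r \<in> carrier S" "star_meet z r = Pop_down S z"
    and "\<And>v. \<lbrakk>v \<in> carrier S; star_meet z v = Pop_down S z\<rbrakk> \<Longrightarrow> star_le v r"
  shows "Row S z = r"
  using assms by (intro S.Row_eqI) (simp_all add: meet_eq le_iff)

lemma Pop_down_Inl:
  assumes x: "x \<in> carrier A"
  shows "Pop_down S (Inl x) = Inl (Pop_down A x)"
proof (rule Pop_down_star)
  show "star_le (Inl (Pop_down A x)) c" if "covered_by S c (Inl x)" for c
    using that A.Pop_down(3)[OF x] by (cases c) simp_all
  show "star_le v (Inl (Pop_down A x))"
    if v: "v \<in> carrier S" "star_le v (Inl x)" "\<And>c. covered_by S c (Inl x) \<Longrightarrow> star_le v c" for v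
    using v(1)
  proof (cases rule: carrier_cases)
    case (1 a)
    have "a \<sqsubseteq>\<^bsub>A\<^esub> c" if "covered_by A c x" for c
      using v(3)[of "Inl c"] that 1 by simp
    then show ?thesis using 1 v(2) A.Pop_down(4)[OF x, of a] by simp
  qed (use v in simp)
qed (use x A.Pop_down in simp_all)

text \<open>An element of \<open>B\<close> solves the equation for \<open>bA i\<close> iff the top
  of \<open>A\<close> on its level does. By \<open>A.Row_b\<close> the solutions in \<open>A\<close>
  stay on levels up to \<open>prev_level n i\<close>, so \<open>tB\<close> of that level exceeds all
  solutions of either kind.\<close>

lemma Row_Inl_bot_at:
  assumes i: "i \<le> n"
  shows "Row S (Inl (bA i)) = Inr (tB (prev_level n i))"
proof (rule Row_star)
  have j: "prev_level n i \<le> n" using i by (rule prev_level_le)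
  have C: "bA i \<in> carrier A" using i by (rule A.bot_at)
  show "Inl (bA i) \<in> carrier S" "Inr (tB (prev_level n i)) \<in> carrier S"
    using C j by (simp_all add: B.top_at)
  have meet: "bA i \<sqinter>\<^bsub>A\<^esub> tA (prev_level n i) = Pop_down A (bA i)"
    using A.Row(2)[OF C] A.Row_b[OF i] by simp
  then show "star_meet (Inl (bA i)) (Inr (tB (prev_level n i))) = Pop_down S (Inl (bA i))"
    using j C by (simp add: Pop_down_Inl B.top_at meet_comm)
  have le: "A.level a \<le> prev_level n i"
    if "a \<in> carrier A" "bA i \<sqinter>\<^bsub>A\<^esub> a = Pop_down A (bA i)" for a
    using A.Row(3)[OF C that] j that by (simp add: A.Row_b[OF i] A.le_t_iff)
  show "star_le v (Inr (tB (prev_level n i)))"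
    if v: "v \<in> carrier S" "star_meet (Inl (bA i)) v = Pop_down S (Inl (bA i))" for v
    using v(1)
  proof (cases rule: carrier_cases)
    case (1 a)
    then show ?thesis using v le j C by (simp add: Pop_down_Inl B.top_at)
  next
    case (2 d)
    then have "B.level d \<le> prev_level n i"
      using v le[of "tA (B.level d)"] C
      by (simp add: Pop_down_Inl A.top_at B.level_le_n meet_comm)
    then show ?thesis using 2 j by (simp add: B.le_t_iff)
  qed
qed

lemma Row_Inl:
  assumes x: "x \<in> carrier A" "x \<noteq> bA (A.level x)"
  shows "Row S (Inl x) = Inl (Row A x)"
proof (rule Row_star)
  show "star_meet (Inl x) (Inl (Row A x)) = Pop_down S (Inl x)"
    using x A.Row(2)[OF x(1)] by (simp add: Pop_down_Inl)
  show "star_le v (Inl (Row A x))"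
    if v: "v \<in> carrier S" "star_meet (Inl x) v = Pop_down S (Inl x)" for v
    using v(1)
  proof (cases rule: carrier_cases)
    case (1 a)
    then show ?thesis using v x A.Row(3)[OF x(1)] by (simp add: Pop_down_Inl)
  next
    case (2 d)
    \<comment> \<open>A solution in \<open>B\<close> would make \<open>Pop_down A x\<close> a meet
      with a top, which only the elements \<open>bA i\<close> allow.\<close>
    then have "x \<sqinter>\<^bsub>A\<^esub> tA (B.level d) = Pop_down A x" using v x by (simp add: Pop_down_Inl meet_comm)
    then have False using A.meet_t_eq_Pop_down[OF x(1) B.level_le_n[OF 2(2)]] x(2) by blast
    then show ?thesis ..
  qed
qed (use x A.Row in simp_all)

text \<open>All lower covers of \<open>y\<close> are in \<open>B\<close>, but elements of
  \<open>A\<close> still compete as lower bounds. They count only through their level, which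
  \<open>B.level_Pop_down_ge\<close> controls.\<close>

lemma Pop_down_Inr:
  assumes y: "y \<in> carrier B" "y \<noteq> bB (B.level y)"
  shows "Pop_down S (Inr y) = Inr (Pop_down B y)"
proof (rule Pop_down_star)
  have no_Inl: "\<not> covered_by S (Inl a) (Inr y)" for a using y by (auto simp: B.bot_at)
  show "star_le (Inr (Pop_down B y)) c" if "covered_by S c (Inr y)" for c
  proof (cases c)
    case (Inl a)
    then show ?thesis using that no_Inl[of a] by blast
  next
    case (Inr d)
    then show ?thesis using that B.Pop_down(3)[OF y(1)] by simp
  qed
  show "star_le v (Inr (Pop_down B y))"
    if v: "v \<in> carrier S" "star_le v (Inr y)" "\<And>c. covered_by S c (Inr y) \<Longrightarrow> star_le v c" for v
    using v(1)
  proof (cases rule: carrier_cases)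
    case (1 a)
    have "A.level a \<le> B.level c" if "covered_by B c y" for c
      using v(3)[of "Inr c"] that 1 by simp
    then show ?thesis using 1 v(2) B.level_Pop_down_ge[OF y(1), of "A.level a"] by simp
  next
    case (2 d)
    have "d \<sqsubseteq>\<^bsub>B\<^esub> c" if "covered_by B c y" for c
      using v(3)[of "Inr c"] that 2 by simp
    then show ?thesis using 2 v(2) B.Pop_down(4)[OF y(1), of d] by simp
  qed
qed (use y B.Pop_down in simp_all)

lemma Row_Inr:
  assumes y: "y \<in> carrier B" "y \<noteq> bB (B.level y)"
  shows "Row S (Inr y) = Inr (Row B y)"
proof (rule Row_star)
  show "star_meet (Inr y) (Inr (Row B y)) = Pop_down S (Inr y)"
    using y B.Row(2)[OF y(1)] by (simp add: Pop_down_Inr)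
  show "star_le v (Inr (Row B y))"
    if v: "v \<in> carrier S" "star_meet (Inr y) v = Pop_down S (Inr y)" for v
    using v(1)
  proof (cases rule: carrier_cases)
    case (1 a)
    then show ?thesis using v y by (simp add: Pop_down_Inr)
  next
    case (2 d)
    then show ?thesis using v y B.Row(3)[OF y(1)] by (simp add: Pop_down_Inr)
  qed
qed (use y B.Row in simp_all)

text \<open>The lower covers are \<open>tA i\<close> and, for positive \<open>i\<close>, also
  \<open>bB (i - 1)\<close>; their common lower bounds are the elements of \<open>A\<close> on
  levels up to \<open>i - 1\<close>. For \<open>i = 0\<close> only \<open>tA 0\<close> remains, and
  truncated subtraction gives exactly this.\<close>

lemma Pop_down_Inr_bot_at:
  assumes i: "i \<le> n"
  shows "Pop_down S (Inr (bB i)) = Inl (tA (i - 1))"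
proof (rule Pop_down_star)
  have C: "bB i \<in> carrier B" using i by (rule B.bot_at)
  show "Inr (bB i) \<in> carrier S" "Inl (tA (i - 1)) \<in> carrier S"
    "star_le (Inl (tA (i - 1))) (Inr (bB i))"
    using i by (simp_all add: A.top_at B.bot_at)
  show "star_le (Inl (tA (i - 1))) c" if c: "covered_by S c (Inr (bB i))" for c
  proof (cases c)
    case (Inl a)
    then obtain m where m: "m \<le> n" "a = tA m" "bB i = bB m" using c by auto
    have "B.level (bB i) = B.level (bB m)" by (simp only: m(3))
    then have "i = m" by (simp only: B.h_b[OF i] B.h_b[OF m(1)])
    then show ?thesis using Inl i m(2) A.top_at_mono[of "i - 1" i] by simp
  next
    case (Inr d)
    then have d: "covered_by B d (bB i)" using c by simp
    show ?thesis
    proof (cases i)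
      case 0
      then have False
        using B.covered_byD[OF d] B.b_0_le B.le_antisym by auto
      then show ?thesis ..
    next
      case (Suc j)
      then show ?thesis
        using Inr d i B.lower_cover_b_Suc[of j d] by (simp add: A.top_at B.bot_at)
    qed
  qed
  show "star_le v (Inl (tA (i - 1)))"
    if v: "v \<in> carrier S" "\<And>c. covered_by S c (Inr (bB i)) \<Longrightarrow> star_le v c" for v
  proof -
    have "covered_by S (Inl (tA i)) (Inr (bB i))" using i by auto
    from v(2)[OF this] have le: "star_le v (Inl (tA i))" .
    then obtain a where a: "v = Inl a" "a \<in> carrier A" using v(1) by (cases v) auto
    have "A.level a \<le> i - 1"
    proof (cases i)
      case 0
      then show ?thesis using le a i by (simp add: A.le_t_iff)
    next
      case (Suc j)
      then show ?thesis
        using v(2)[of "Inr (bB j)"] a i B.bot_at_cover[of j] by (simp add: B.bot_at)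
    qed
    then show ?thesis using a i by (simp add: A.le_t_iff)
  qed
qed

text \<open>\<open>Pop_down\<close> lies in \<open>A\<close>, so no element of \<open>B\<close> is a
  solution. For \<open>a\<close> in \<open>A\<close>, levels give
  \<open>min i (A.level a) = i - 1\<close>: this fixes the level for positive \<open>i\<close> and
  leaves it free, up to \<open>n\<close>, for \<open>i = 0\<close>, in accordance with
  \<open>prev_level\<close>.\<close>

lemma Row_Inr_bot_at:
  assumes i: "i \<le> n"
  shows "Row S (Inr (bB i)) = Inl (tA (prev_level n i))"
proof (rule Row_star)
  have j: "prev_level n i \<le> n" using i by (rule prev_level_le)
  show "Inr (bB i) \<in> carrier S" "Inl (tA (prev_level n i)) \<in> carrier S"
    using i j by (simp_all add: A.top_at B.bot_at)
  have "tA i \<sqinter>\<^bsub>A\<^esub> tA (prev_level n i) = tA (i - 1)"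
    using i j A.top_at_mono
    by (intro A.meet_eqI) (auto simp: A.top_at A.le_t_iff prev_level_def split: if_splits)
  then show "star_meet (Inr (bB i)) (Inl (tA (prev_level n i))) = Pop_down S (Inr (bB i))"
    using i by (simp add: Pop_down_Inr_bot_at B.bot_at)
  show "star_le v (Inl (tA (prev_level n i)))"
    if v: "v \<in> carrier S" "star_meet (Inr (bB i)) v = Pop_down S (Inr (bB i))" for v
    using v(1)
  proof (cases rule: carrier_cases)
    case (1 a)
    then have "tA i \<sqinter>\<^bsub>A\<^esub> a = tA (i - 1)"
      using v i by (simp add: Pop_down_Inr_bot_at B.bot_at)
    from arg_cong[OF this, of A.level] have "min i (A.level a) = i - 1"
      using i 1 by (simp add: A.h_meet A.top_at)
    then have "A.level a \<le> prev_level n i"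
      using A.level_le_n[OF 1(2)] by (auto simp: prev_level_def min_def split: if_splits)
    then show ?thesis using 1 j by (simp add: A.le_t_iff)
  next
    case (2 d)
    then show ?thesis using v i by (simp add: Pop_down_Inr_bot_at)
  qed
qed

section \<open>Rowmotion on \<open>A * B\<close> as an injective map\<close>

lemma Row_star_Inl:
  assumes "x \<in> carrier A"
  shows "Row S (Inl x) =
    (if x = bA (A.level x) then Inr (tB (prev_level n (A.level x))) else Inl (Row A x))"
  using Row_Inl[OF assms] Row_Inl_bot_at[OF A.level_le_n[OF assms]] by auto

lemma Row_star_Inr:
  assumes "y \<in> carrier B"
  shows "Row S (Inr y) =
    (if y = bB (B.level y) then Inl (tA (prev_level n (B.level y))) else Inr (Row B y))"
  using Row_Inr[OF assms] Row_Inr_bot_at[OF B.level_le_n[OF assms]] by auto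


text \<open>Crossing elements are sent to tops of the other factor, which determine the level they
  started from. Other elements keep their image in the factor, which is never a top, so the two
  kinds do not collide.\<close>

lemma Row_star_inj: "inj_on (Row S) (carrier S)"
proof (rule inj_onI)
  have A_top: "Row A x \<noteq> tA (prev_level n i)"
    if "x \<in> carrier A" "x \<noteq> bA (A.level x)" "i \<le> n" for x i
    using A.Row_eq_t[OF that(1) prev_level_le[OF that(3)]] that(2) by blast
  have B_top: "Row B y \<noteq> tB (prev_level n i)"
    if "y \<in> carrier B" "y \<noteq> bB (B.level y)" "i \<le> n" for y i
    using B.Row_eq_t[OF that(1) prev_level_le[OF that(3)]] that(2) by blast
  have A_eq: "i = j" if "tA (prev_level n i) = tA (prev_level n j)" "i \<le> n" "j \<le> n" for i j
    using arg_cong[OF that(1), of A.level] that(2,3)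
    by (intro prev_level_inj[of i n j]) (simp_all add: A.top_at prev_level_le)
  have B_eq: "i = j" if "tB (prev_level n i) = tB (prev_level n j)" "i \<le> n" "j \<le> n" for i j
    using arg_cong[OF that(1), of B.level] that(2,3)
    by (intro prev_level_inj[of i n j]) (simp_all add: B.top_at prev_level_le)
  fix z w assume z: "z \<in> carrier S" and w: "w \<in> carrier S" and eq: "Row S z = Row S w"
  from z show "z = w"
  proof (cases rule: carrier_cases)
    case z: (1 x)
    from w show ?thesis
    proof (cases rule: carrier_cases)
      case w: (1 x')
      note n = A.level_le_n[OF z(2)] A.level_le_n[OF w(2)]
      show ?thesis
      proof (cases "x = bA (A.level x)")
        case b: True
        then have b': "x' = bA (A.level x')"
          using eq z w by (simp add: Row_star_Inl split: if_splits)
        then have "A.level x = A.level x'"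
          using b eq z w n B_eq by (auto simp: Row_star_Inl split: if_splits)
        then show ?thesis unfolding z w by (subst b, subst b') simp
      next
        case nb: False
        then have "Row A x = Row A x'"
          using eq z w by (simp add: Row_star_Inl split: if_splits)
        then show ?thesis using A.Row_inj z w by (auto dest: inj_onD)
      qed
    next
      case w: (2 y)
      note n = A.level_le_n[OF z(2)] B.level_le_n[OF w(2)]
      show ?thesis
        using eq z w A_top[of x "B.level y"] B_top[of y "A.level x"] n
        by (auto simp: Row_star_Inl Row_star_Inr split: if_splits)
    qed
  next
    case z: (2 y)
    from w show ?thesis
    proof (cases rule: carrier_cases)
      case w: (1 x)
      note n = A.level_le_n[OF w(2)] B.level_le_n[OF z(2)]
      show ?thesis
        using eq z w A_top[of x "B.level y"] B_top[of y "A.level x"] n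
        by (auto simp: Row_star_Inl Row_star_Inr split: if_splits)
    next
      case w: (2 y')
      note n = B.level_le_n[OF z(2)] B.level_le_n[OF w(2)]
      show ?thesis
      proof (cases "y = bB (B.level y)")
        case b: True
        then have b': "y' = bB (B.level y')"
          using eq z w by (simp add: Row_star_Inr split: if_splits)
        then have "B.level y = B.level y'"
          using b eq z w n A_eq by (auto simp: Row_star_Inr split: if_splits)
        then show ?thesis unfolding z w by (subst b, subst b') simp
      next
        case nb: False
        then have "Row B y = Row B y'"
          using eq z w by (simp add: Row_star_Inr split: if_splits)
        then show ?thesis using B.Row_inj z w by (auto dest: inj_onD)
      qed
    qed
  qed
qed

end

section \<open>Orbits\<close>

lemma orbit_subset_closed:
  assumes "z \<in> C" "\<And>x. x \<in> C \<Longrightarrow> f x \<in> C"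
  shows "orbit f z \<subseteq> C"
proof
  fix x assume "x \<in> orbit f z"
  then show "x \<in> C" by induction (use assms in auto)
qed

lemma orbit_conj:
  assumes z: "z \<in> C" and closed: "\<And>x. x \<in> C \<Longrightarrow> f x \<in> C"
    and conj: "\<And>x. x \<in> C \<Longrightarrow> g (s x) = s (f x)"
  shows "orbit g (s z) = s ` orbit f z"
proof (intro Set.set_eqI iffI)
  have C: "x \<in> C" if "x \<in> orbit f z" for x using orbit_subset_closed[of z C f] z closed that by blast
  fix y
  show "y \<in> s ` orbit f z" if "y \<in> orbit g (s z)"
    using that
  proof induction
    case base
    then show ?case using conj[OF z] by (auto intro: orbit.base)
  next
    case (step y)
    then obtain x where "x \<in> orbit f z" "y = s x" by blast
    then show ?case using conj[OF C] by (auto intro: orbit.step)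
  qed
  have "s x \<in> orbit g (s z)" if "x \<in> orbit f z" for x
    using that
  proof induction
    case base
    then show ?case unfolding conj[OF z, symmetric] by (rule orbit.base)
  next
    case (step x)
    then show ?case using orbit.step[OF step.IH] conj[OF C[OF step.hyps]] by simp
  qed
  then show "y \<in> orbit g (s z)" if "y \<in> s ` orbit f z" using that by blast
qed

abbreviation swap_sum :: "'a + 'b \<Rightarrow> 'b + 'a" where
  "swap_sum \<equiv> case_sum Inr Inl"

lemma inj_swap_sum: "inj swap_sum"
  by (rule injI) (simp split: sum.splits)

section \<open>Exchanging the two factors\<close>

context switching_pair
begin

sublocale R: switching_pair B A n posB posA
  by unfold_locales

lemma Row_swap:
  assumes "z \<in> carrier S"
  shows "Row R.S (swap_sum z) = swap_sum (Row S z)"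
  using assms
  by (elim carrier_cases) (simp_all add: Row_star_Inl Row_star_Inr R.Row_star_Inl R.Row_star_Inr)

lemma orbit_swap_sum: "z \<in> carrier S \<Longrightarrow> orbit (Row R.S) (swap_sum z) = swap_sum ` orbit (Row S) z"
  using orbit_conj[of z "carrier S" "Row S" "Row R.S" swap_sum] S.Row(1) Row_swap by blast

lemma Row_orbits_swap: "Row_orbits R.S = (`) swap_sum ` Row_orbits S"
proof -
  have "carrier R.S = swap_sum ` carrier S"
    by (auto simp: star_poset_def image_Un image_image Plus_def)
  then have "Row_orbits R.S = (\<lambda>z. orbit (Row R.S) (swap_sum z)) ` carrier S"
    unfolding Row_orbits_def by (simp add: image_image)
  also have "\<dots> = (\<lambda>z. swap_sum ` orbit (Row S) z) ` carrier S"
    by (intro image_cong) (simp_all add: orbit_swap_sum)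
  finally show ?thesis unfolding Row_orbits_def by (simp add: image_image)
qed

text \<open>
  Going from \<open>A * B\<close> to \<open>B * A\<close>, the leftmost elements of \<open>B\<close> lose a lower cover and those
  of \<open>A\<close> gain one. Rowmotion crosses from \<open>A\<close> to \<open>B\<close> exactly at the latter and back exactly
  at the former, hence a closed orbit contains equally many of both.
\<close>
lemma sum_ddeg_swap:
  assumes X: "X \<in> Row_orbits S"
  shows "(\<Sum>z\<in>swap_sum ` X. ddeg R.S z) = (\<Sum>z\<in>X. ddeg S z)"
proof -
  obtain z0 where z0: "z0 \<in> carrier S" "X = orbit (Row S) z0"
    using X unfolding Row_orbits_def by blast
  have XS: "X \<subseteq> carrier S"
    unfolding z0(2) using z0(1) S.Row(1) by (rule orbit_subset_closed)
  have fin: "finite X" by (rule finite_subset[OF XS S.finite_carrier])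
  have inj: "inj_on (Row S) X" by (rule inj_on_subset[OF Row_star_inj XS])
  have "Row S ` X \<subseteq> X" unfolding z0(2) by (auto intro: orbit.step)
  \<comment> \<open>On a finite set an injective self-map is onto, so sums over \<open>X\<close> can
    be reindexed along rowmotion.\<close>
  then have im: "Row S ` X = X" by (rule endo_inj_surj[OF fin _ inj])
  \<comment> \<open>One step of rowmotion changes \<open>inA\<close> by \<open>outB - outA\<close>,
    and these changes cancel around the orbit. The values are integers because down-degrees are
    corrected in both directions.\<close>
  define inA :: "'a + 'b \<Rightarrow> int" where "inA = case_sum (\<lambda>_. 1) (\<lambda>_. 0)"
  define outA :: "'a + 'b \<Rightarrow> int"
    where "outA = case_sum (\<lambda>x. if x = bA (A.level x) then 1 else 0) (\<lambda>_. 0)"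
  define outB :: "'a + 'b \<Rightarrow> int"
    where "outB = case_sum (\<lambda>_. 0) (\<lambda>y. if y = bB (B.level y) then 1 else 0)"
  have "(\<Sum>z\<in>X. inA z) = (\<Sum>z\<in>X. inA (Row S z))"
    using sum.reindex[OF inj, of inA] im by simp
  also have "\<dots> = (\<Sum>z\<in>X. inA z - outA z + outB z)"
    using XS by (intro sum.cong)
      (auto simp: inA_def outA_def outB_def Row_star_Inl Row_star_Inr elim!: carrier_cases)
  finally have eq: "(\<Sum>z\<in>X. outA z) = (\<Sum>z\<in>X. outB z)"
    by (simp add: sum.distrib sum_subtractf)
  have "int (\<Sum>z\<in>swap_sum ` X. ddeg R.S z) = (\<Sum>z\<in>X. int (ddeg R.S (swap_sum z)))"
    using sum.reindex[OF inj_on_subset[OF inj_swap_sum subset_UNIV]] by simp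
  also have "\<dots> = (\<Sum>z\<in>X. int (ddeg S z) + outA z - outB z)"
    using XS by (intro sum.cong)
      (auto simp: outA_def outB_def ddeg_Inl ddeg_Inr R.ddeg_Inl R.ddeg_Inr elim!: carrier_cases)
  also have "\<dots> = int (\<Sum>z\<in>X. ddeg S z)"
    using eq by (simp add: sum.distrib sum_subtractf)
  finally show ?thesis by (simp only: of_nat_eq_iff)
qed

end

theorem theorem4p8:
  fixes A :: "'a gorder" and B :: "'b gorder"
    and posA :: "'a \<Rightarrow> nat \<times> nat" and posB :: "'b \<Rightarrow> nat \<times> nat"
    and n :: nat
  assumes "finite_semidistributive_lattice A" and "n_switching n A posA"
    and "finite_semidistributive_lattice B" and "n_switching n B posB"
  shows
    "finite_semidistributive_lattice (star_poset n A posA B posB) \<and>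
     orbit_structure (star_poset n A posA B posB) = orbit_structure (star_poset n B posB A posA) \<and>
     (\<exists>\<phi>. bij_betw \<phi> (Row_orbits (star_poset n A posA B posB))
                      (Row_orbits (star_poset n B posB A posA)) \<and>
          (\<forall>X\<in>Row_orbits (star_poset n A posA B posB).
             card (\<phi> X) = card X \<and>
             (\<Sum>x\<in>\<phi> X. ddeg (star_poset n B posB A posA) x) =
             (\<Sum>x\<in>X. ddeg (star_poset n A posA B posB) x)))"
proof -
  interpret A: switching_lattice A n posA by (rule switching_latticeI) fact+
  interpret B: switching_lattice B n posB by (rule switching_latticeI) fact+
  interpret switching_pair A B n posA posB by unfold_locales
  let ?f = "(`) (swap_sum :: 'a + 'b \<Rightarrow> 'b + 'a)"
  have inj: "inj_on ?f (Row_orbits S)"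
    by (rule inj_on_image, rule inj_on_subset[OF inj_swap_sum subset_UNIV])
  have card: "card (?f X) = card X" for X
    by (rule card_image[OF inj_on_subset[OF inj_swap_sum subset_UNIV]])
  have "orbit_structure R.S = image_mset card (image_mset ?f (mset_set (Row_orbits S)))"
    unfolding orbit_structure_def Row_orbits_swap image_mset_mset_set[OF inj] ..
  then have "orbit_structure R.S = orbit_structure S"
    by (simp add: orbit_structure_def image_mset.compositionality comp_def card)
  moreover have "bij_betw ?f (Row_orbits S) (Row_orbits R.S)"
    using inj unfolding Row_orbits_swap bij_betw_def by simp
  ultimately show ?thesis
    using semidistributive_star card sum_ddeg_swap
    by (intro conjI exI[of _ ?f] ballI) simp_all
qed

end
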